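(* Let $\varphi\in L^2(\mathbb{R})$ be a scale-$2$ father function, let $U\varphi=\sum_ka_k\varphi(\cdot-k)$ be the expansion of $U\varphi$ in the orthonormal family $\{\varphi(\cdot-k)\}_{k\in\mathbb{Z}}$, and let $m_0$ be the function on $\mathbb{T}$ given by $m_0=\sum_ka_kz^k$, $z=e^{-it}$. Then $|m_0(z)|\neq1$ for a set of $z$ of positive measure. In particular the operator $S_0:L^2(\mathbb{T})\to L^2(\mathbb{T})$ defined by $(S_0\xi)(z)=m_0(z)\xi(z^2)$ is a shift.
   Context: $(U\xi)(x)=2^{-1/2}\xi(x/2)$ on $L^2(\mathbb{R})$. A scale-$2$ father function is $\varphi\in L^2(\mathbb{R})$ such that $\{\varphi(\cdot-k):k\in\mathbb{Z}\}$ is an orthonormal set; with $\mathcal{V}_0$ the closed linear span of this set, $U\varphi\in\mathcal{V}_0$; and with $\mathcal{V}_n=U^n\mathcal{V}_0$, $\bigcap_n\mathcal{V}_n=\{0\}$ and $\overline{\bigcup_n\mathcal{V}_n}=L^2(\mathbb{R})$. $\mathbb{T}$ carries normalized Haar measure. An isometry $S$ on a Hilbert space $\mathcal{H}$ is a shift if $\bigcap_nS^n\mathcal{H}=\{0\}$. *)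

theory Defs
  imports "HOL-Probability.Probability"
begin

text \<open>
  Elements of the Hilbert space \<open>L\<^sup>2(M)\<close> are represented by measurable square-integrable
  functions. Equality in \<open>L\<^sup>2(M)\<close> is equality almost everywhere, so a subspace is represented by
  the set of all representatives of its elements, and the zero subspace is \<open>L2_zero M\<close>.
\<close>

definition L2 :: "'a measure \<Rightarrow> ('a \<Rightarrow> complex) set" where
  "L2 M = {f \<in> borel_measurable M. integrable M (\<lambda>x. (cmod (f x))\<^sup>2)}"

definition L2_zero :: "'a measure \<Rightarrow> ('a \<Rightarrow> complex) set" where
  "L2_zero M = {f \<in> L2 M. AE x in M. f x = 0}"

definition L2_inner :: "'a measure \<Rightarrow> ('a \<Rightarrow> complex) \<Rightarrow> ('a \<Rightarrow> complex) \<Rightarrow> complex" where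
  "L2_inner M f g = (LINT x|M. f x * cnj (g x))"

definition L2_norm :: "'a measure \<Rightarrow> ('a \<Rightarrow> complex) \<Rightarrow> real" where
  "L2_norm M f = sqrt (LINT x|M. (cmod (f x))\<^sup>2)"

definition L2_closure :: "'a measure \<Rightarrow> ('a \<Rightarrow> complex) set \<Rightarrow> ('a \<Rightarrow> complex) set" where
  "L2_closure M A = {f \<in> L2 M. \<forall>\<epsilon>>0. \<exists>g\<in>A. L2_norm M (\<lambda>x. f x - g x) < \<epsilon>}"

definition fun_span :: "('a \<Rightarrow> complex) set \<Rightarrow> ('a \<Rightarrow> complex) set" where
  "fun_span A = {(\<lambda>x. \<Sum>g\<in>B. c g * g x) | B c. finite B \<and> B \<subseteq> A}"

text \<open>Unconditional convergence of a series in the norm of \<open>L\<^sup>2(M)\<close>.\<close>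

definition L2_has_sum ::
  "'a measure \<Rightarrow> ('i \<Rightarrow> 'a \<Rightarrow> complex) \<Rightarrow> ('a \<Rightarrow> complex) \<Rightarrow> 'i set \<Rightarrow> bool" where
  "L2_has_sum M f s I \<longleftrightarrow> s \<in> L2 M \<and> (\<forall>i\<in>I. f i \<in> L2 M) \<and>
     ((\<lambda>F. L2_norm M (\<lambda>x. s x - (\<Sum>i\<in>F. f i x))) \<longlongrightarrow> 0) (finite_subsets_at_top I)"

definition L2_orthonormal :: "'a measure \<Rightarrow> ('i \<Rightarrow> 'a \<Rightarrow> complex) \<Rightarrow> 'i set \<Rightarrow> bool" where
  "L2_orthonormal M f I \<longleftrightarrow> (\<forall>i\<in>I. f i \<in> L2 M) \<and>
     (\<forall>i\<in>I. \<forall>j\<in>I. L2_inner M (f i) (f j) = (if i = j then 1 else 0))"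

text \<open>A map on functions that induces a linear operator on \<open>L\<^sup>2(M)\<close>.\<close>

definition L2_linear_operator :: "'a measure \<Rightarrow> (('a \<Rightarrow> complex) \<Rightarrow> ('a \<Rightarrow> complex)) \<Rightarrow> bool" where
  "L2_linear_operator M S \<longleftrightarrow>
     (\<forall>f\<in>L2 M. S f \<in> L2 M) \<and>
     (\<forall>f\<in>L2 M. \<forall>g\<in>L2 M. (AE x in M. f x = g x) \<longrightarrow> (AE x in M. S f x = S g x)) \<and>
     (\<forall>f\<in>L2 M. \<forall>g\<in>L2 M. \<forall>a b.
        AE x in M. S (\<lambda>y. a * f y + b * g y) x = a * S f x + b * S g x)"

definition L2_isometry :: "'a measure \<Rightarrow> (('a \<Rightarrow> complex) \<Rightarrow> ('a \<Rightarrow> complex)) \<Rightarrow> bool" where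
  "L2_isometry M S \<longleftrightarrow> L2_linear_operator M S \<and> (\<forall>f\<in>L2 M. L2_norm M (S f) = L2_norm M f)"

definition L2_range :: "'a measure \<Rightarrow> (('a \<Rightarrow> complex) \<Rightarrow> ('a \<Rightarrow> complex)) \<Rightarrow> ('a \<Rightarrow> complex) set" where
  "L2_range M S = {f \<in> L2 M. \<exists>g\<in>L2 M. AE x in M. f x = S g x}"

definition L2_shift :: "'a measure \<Rightarrow> (('a \<Rightarrow> complex) \<Rightarrow> ('a \<Rightarrow> complex)) \<Rightarrow> bool" where
  "L2_shift M S \<longleftrightarrow> L2_isometry M S \<and> (\<Inter>n::nat. L2_range M (S ^^ n)) = L2_zero M"

definition dilation :: "(real \<Rightarrow> complex) \<Rightarrow> real \<Rightarrow> complex" where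
  "dilation f x = complex_of_real (2 powr (-1/2)) * f (x / 2)"

text \<open>The integer powers of the dilation operator, which is a bijection on functions.\<close>

definition dilation_pow :: "int \<Rightarrow> (real \<Rightarrow> complex) \<Rightarrow> real \<Rightarrow> complex" where
  "dilation_pow n = (if n \<ge> 0 then dilation ^^ nat n else inv dilation ^^ nat (- n))"

lemma bij_dilation: "bij dilation"
proof (rule o_bij)
  let ?g = "\<lambda>(f::real\<Rightarrow>complex) x. complex_of_real (2 powr (1/2)) * f (2 * x)"
  have inverses: "complex_of_real (2 powr (1/2)) * complex_of_real (2 powr - (1/2)) = 1"
    by (simp flip: of_real_mult powr_add)
  show "?g \<circ> dilation = id" "dilation \<circ> ?g = id"
    using inverses by (simp_all add: fun_eq_iff dilation_def mult.commute)
qed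

definition translate :: "real \<Rightarrow> (real \<Rightarrow> complex) \<Rightarrow> real \<Rightarrow> complex" where
  "translate k f x = f (x - k)"

definition multires_space :: "(real \<Rightarrow> complex) \<Rightarrow> int \<Rightarrow> (real \<Rightarrow> complex) set" where
  "multires_space \<phi> n =
     dilation_pow n ` L2_closure lborel (fun_span (range (\<lambda>k::int. translate (of_int k) \<phi>)))"

definition scale2_father :: "(real \<Rightarrow> complex) \<Rightarrow> bool" where
  "scale2_father \<phi> \<longleftrightarrow>
     \<phi> \<in> L2 lborel \<and>
     L2_orthonormal lborel (\<lambda>k::int. translate (of_int k) \<phi>) UNIV \<and>
     dilation \<phi> \<in> multires_space \<phi> 0 \<and>
     (\<Inter>n. multires_space \<phi> n) = L2_zero lborel \<and>
     L2_closure lborel (\<Union>n. multires_space \<phi> n) = L2 lborel"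

text \<open>Normalized Haar measure on the unit circle, in the coordinate \<open>z = exp (- \<i> t)\<close>.\<close>

definition circle_haar :: "complex measure" where
  "circle_haar =
     distr (uniform_measure lborel {0..<2*pi}) (restrict_space borel (sphere 0 1)) (\<lambda>t. cis (- t))"

lemma prob_space_circle_haar: "prob_space circle_haar"
  unfolding circle_haar_def
proof (rule prob_space.prob_space_distr)
  show "prob_space (uniform_measure lborel {0..<2*pi})"
    by (rule prob_space_uniform_measure) simp_all
  have "(\<lambda>t. cis (- t)) \<in> borel_measurable borel"
    by (intro borel_measurable_continuous_onI continuous_intros)
  then have "(\<lambda>t. cis (- t)) \<in> lborel \<rightarrow>\<^sub>M restrict_space borel (sphere 0 1)"
    by (intro measurable_restrict_space2) auto
  then show "(\<lambda>t. cis (- t)) \<in> uniform_measure lborel {0..<2*pi} \<rightarrow>\<^sub>M restrict_space borel (sphere 0 1)"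
    by (simp cong: measurable_cong_sets)
qed

definition filter_operator :: "(complex \<Rightarrow> complex) \<Rightarrow> (complex \<Rightarrow> complex) \<Rightarrow> complex \<Rightarrow> complex" where
  "filter_operator m \<xi> z = m z * \<xi> (z\<^sup>2)"

end

(*
  The isometry from L^2 of the circle onto V_0 that sends z^k to phi(. - k) sends m_0 to U phi, and
  therefore intertwines S_0 with the restriction of U to V_0. So S_0 is an isometry, and the
  intersection of its ranges corresponds to the intersection of the V_n, which is zero.

  If |m_0| = 1 almost everywhere, the integer translates of U phi are orthonormal, so phi is
  orthogonal to its translates by nonzero half-integers. Repeating this, phi is orthogonal to all
  its translates by nonzero dyadic rationals, which contradicts the continuity of translations in
  L^2 of the line.
*)

theory Submission
  imports Defs
begin

text \<open>Write T_s for translation by s. Both claims rest on one identity: <T_k U phi, U phi> is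
  the integral of |m_0|^2 z^k. Since U T_s = T_{2s} U and U is unitary, this number is also <T_{k/2}
  phi, phi>. The even coefficients are thus fixed by the orthonormality of the family, and they
  alone make S_0 isometric; unimodularity would kill the odd ones as well. The repetition works
  because U phi lies in V_0: if phi is orthogonal to T_{k+s} phi for all integers k, then V_0 is
  orthogonal to T_s V_0, hence U phi to T_s U phi, and removing U halves s. Two obstacles shape the
  proof. First, m_0 is only known to be square-integrable, so m_0(z) xi(z^2) must be shown to lie in
  L^2 before the intertwining can pass to limits. This is done by comparing measures: the image of
  |m_0|^2 times Haar measure under squaring has the Fourier coefficients of Haar measure. Secondly,
  vectors are functions, not classes, while V_n is an image under pointwise dilation; statements
  known almost everywhere have to be turned into membership of the given representative.\<close>

section \<open>Square-integrable functions\<close>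

lemma L2_measurable: "f \<in> L2 M \<Longrightarrow> f \<in> borel_measurable M"
  by (simp add: L2_def)

lemma L2_integrable: "f \<in> L2 M \<Longrightarrow> integrable M (\<lambda>x. (cmod (f x))\<^sup>2)"
  by (simp add: L2_def)

lemma L2_dominated:
  assumes "f \<in> borel_measurable M" "integrable M u"
    and "AE x in M. (cmod (f x))\<^sup>2 \<le> u x"
  shows "f \<in> L2 M"
proof -
  have "integrable M (\<lambda>x. (cmod (f x))\<^sup>2)"
  proof (rule Bochner_Integration.integrable_bound[OF assms(2)])
    show "(\<lambda>x. (cmod (f x))\<^sup>2) \<in> borel_measurable M"
      using assms(1) by measurable
    show "AE x in M. norm ((cmod (f x))\<^sup>2) \<le> norm (u x)"
      using assms(3) by eventually_elim simp
  qed
  then show ?thesis using assms(1) by (simp add: L2_def)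
qed

lemma L2_cmult:
  assumes "f \<in> L2 M" shows "(\<lambda>x. c * f x) \<in> L2 M"
  using assms by (auto simp: L2_def norm_mult power_mult_distrib)

lemma L2_add:
  assumes "f \<in> L2 M" "g \<in> L2 M" shows "(\<lambda>x. f x + g x) \<in> L2 M"
proof (rule L2_dominated)
  show "(\<lambda>x. f x + g x) \<in> borel_measurable M"
    using assms by (intro borel_measurable_add L2_measurable)
  show "integrable M (\<lambda>x. 2 * (cmod (f x))\<^sup>2 + 2 * (cmod (g x))\<^sup>2)"
    using assms by (intro Bochner_Integration.integrable_add integrable_mult_right L2_integrable)
  have "(cmod (f x + g x))\<^sup>2 \<le> 2 * (cmod (f x))\<^sup>2 + 2 * (cmod (g x))\<^sup>2" for x
  proof -
    have "(cmod (f x + g x))\<^sup>2 \<le> (cmod (f x) + cmod (g x))\<^sup>2"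
      by (intro power_mono norm_triangle_ineq) simp
    also have "\<dots> \<le> 2 * (cmod (f x))\<^sup>2 + 2 * (cmod (g x))\<^sup>2"
      using zero_le_power2[of "cmod (f x) - cmod (g x)"]
      by (simp add: power2_eq_square algebra_simps)
    finally show ?thesis .
  qed
  then show "AE x in M. (cmod (f x + g x))\<^sup>2 \<le> 2 * (cmod (f x))\<^sup>2 + 2 * (cmod (g x))\<^sup>2"
    by simp
qed

lemma L2_lincomb:
  assumes "f \<in> L2 M" "g \<in> L2 M" shows "(\<lambda>x. a * f x + b * g x) \<in> L2 M"
  using assms by (intro L2_add L2_cmult)

lemma L2_diff:
  assumes "f \<in> L2 M" "g \<in> L2 M" shows "(\<lambda>x. f x - g x) \<in> L2 M"
  using L2_lincomb[OF assms, of 1 "-1"] by simp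

lemma L2_0: "(\<lambda>x. 0) \<in> L2 M"
  by (simp add: L2_def)

lemma L2_sum: "(\<And>i. i \<in> F \<Longrightarrow> f i \<in> L2 M) \<Longrightarrow> (\<lambda>x. \<Sum>i\<in>F. f i x) \<in> L2 M"
  by (induction F rule: infinite_finite_induct) (simp_all add: L2_0 L2_add)

lemma L2_norm_nonneg: "0 \<le> L2_norm M f"
  by (simp add: L2_norm_def)

lemma L2_norm_sq: "(L2_norm M f)\<^sup>2 = (LINT x|M. (cmod (f x))\<^sup>2)"
  by (simp add: L2_norm_def)

lemma L2_inner_integrable:
  assumes "f \<in> L2 M" "g \<in> L2 M" shows "integrable M (\<lambda>x. f x * cnj (g x))"
proof (rule Bochner_Integration.integrable_bound)
  show "integrable M (\<lambda>x. (cmod (f x))\<^sup>2 + (cmod (g x))\<^sup>2)"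
    using assms by (intro Bochner_Integration.integrable_add L2_integrable)
  show "(\<lambda>x. f x * cnj (g x)) \<in> borel_measurable M"
  proof (rule borel_measurable_times[OF L2_measurable[OF assms(1)]])
    have "cnj \<in> borel_measurable borel"
      by (intro borel_measurable_continuous_onI continuous_intros)
    then show "(\<lambda>x. cnj (g x)) \<in> borel_measurable M"
      using L2_measurable[OF assms(2)] by measurable
  qed
  have "cmod (f x) * cmod (g x) \<le> (cmod (f x))\<^sup>2 + (cmod (g x))\<^sup>2" for x
    using zero_le_power2[of "cmod (f x) - cmod (g x)"]
      mult_nonneg_nonneg[of "cmod (f x)" "cmod (g x)", OF norm_ge_zero norm_ge_zero]
    unfolding power2_diff by linarith
  then show "AE x in M. norm (f x * cnj (g x)) \<le> norm ((cmod (f x))\<^sup>2 + (cmod (g x))\<^sup>2)"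
    by (simp add: norm_mult)
qed

lemma L2_inner_self: "L2_inner M f f = of_real ((L2_norm M f)\<^sup>2)"
proof -
  have "f x * cnj (f x) = of_real ((cmod (f x))\<^sup>2)" for x
    by (rule complex_norm_square[symmetric])
  then show ?thesis unfolding L2_inner_def L2_norm_sq by (simp only: integral_complex_of_real)
qed

lemma L2_inner_cnj: "cnj (L2_inner M f g) = L2_inner M g f"
  unfolding L2_inner_def by (simp flip: Bochner_Integration.integral_cnj add: mult.commute)

lemma L2_inner_lincomb_left:
  assumes "f \<in> L2 M" "g \<in> L2 M" "h \<in> L2 M"
  shows "L2_inner M (\<lambda>x. a * f x + b * g x) h = a * L2_inner M f h + b * L2_inner M g h"
proof -
  have "L2_inner M (\<lambda>x. a * f x + b * g x) h
      = (LINT x|M. a * (f x * cnj (h x)) + b * (g x * cnj (h x)))"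
    unfolding L2_inner_def by (simp add: algebra_simps)
  then show ?thesis
    using assms by (simp add: L2_inner_integrable L2_inner_def)
qed

lemma L2_inner_lincomb_right:
  assumes "f \<in> L2 M" "g \<in> L2 M" "h \<in> L2 M"
  shows "L2_inner M h (\<lambda>x. a * f x + b * g x) = cnj a * L2_inner M h f + cnj b * L2_inner M h g"
  using arg_cong[OF L2_inner_lincomb_left[OF assms, of a b], of cnj] by (simp add: L2_inner_cnj)

lemma L2_norm_eq_0_iff:
  assumes "f \<in> L2 M" shows "L2_norm M f = 0 \<longleftrightarrow> (AE x in M. f x = 0)"
  using integral_nonneg_eq_0_iff_AE[OF L2_integrable[OF assms]] by (simp add: L2_norm_def)

lemma L2_norm_lincomb_sq:
  assumes "f \<in> L2 M" "g \<in> L2 M"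
  shows "(L2_norm M (\<lambda>x. a * f x + b * g x))\<^sup>2
    = (cmod a)\<^sup>2 * (L2_norm M f)\<^sup>2 + (cmod b)\<^sup>2 * (L2_norm M g)\<^sup>2
      + 2 * Re (a * cnj b * L2_inner M f g)"
proof -
  let ?h = "\<lambda>x. a * f x + b * g x"
  have "of_real ((L2_norm M ?h)\<^sup>2) = L2_inner M ?h ?h"
    by (simp add: L2_inner_self)
  also have "\<dots> = a * cnj a * L2_inner M f f + b * cnj b * L2_inner M g g
      + (a * cnj b * L2_inner M f g + cnj (a * cnj b * L2_inner M f g))"
    using assms
    by (simp add: L2_inner_lincomb_left L2_inner_lincomb_right L2_lincomb L2_inner_cnj algebra_simps)
  also have "\<dots> = of_real ((cmod a)\<^sup>2 * (L2_norm M f)\<^sup>2 + (cmod b)\<^sup>2 * (L2_norm M g)\<^sup>2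
      + 2 * Re (a * cnj b * L2_inner M f g))"
    by (simp only: complex_add_cnj L2_inner_self complex_norm_square[symmetric] of_real_add
        of_real_mult[symmetric])
  finally show ?thesis by (simp only: of_real_eq_iff)
qed

lemma L2_norm_cmult: "L2_norm M (\<lambda>x. c * f x) = cmod c * L2_norm M f"
  by (simp add: L2_norm_def norm_mult power_mult_distrib real_sqrt_mult)

lemma L2_norm_minus_commute: "L2_norm M (\<lambda>x. f x - g x) = L2_norm M (\<lambda>x. g x - f x)"
  by (simp add: L2_norm_def norm_minus_commute)

lemma L2_Cauchy_Schwarz:
  assumes "f \<in> L2 M" "g \<in> L2 M"
  shows "cmod (L2_inner M f g) \<le> L2_norm M f * L2_norm M g"
proof (cases "L2_norm M g = 0")
  case True
  then have "AE x in M. g x = 0" using assms by (simp add: L2_norm_eq_0_iff)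
  then have "L2_inner M f g = 0"
    unfolding L2_inner_def by (intro integral_eq_zero_AE) auto
  then show ?thesis by (simp add: L2_norm_nonneg)
next
  case False
  define n where "n = L2_norm M g"
  define i where "i = L2_inner M f g"
  have "of_real (n\<^sup>2) * cnj (- i) * i = of_real (- (n\<^sup>2 * (cmod i)\<^sup>2))"
    using complex_norm_square[of i] by (simp add: mult.commute)
  then have cross: "Re (of_real (n\<^sup>2) * cnj (- i) * i) = - (n\<^sup>2 * (cmod i)\<^sup>2)"
    by (simp only: Re_complex_of_real)
  have collect: "p\<^sup>2 * F + c * p + 2 * - (p * c) = p * (p * F - c)" for p F c :: real
    by (simp add: power2_eq_square algebra_simps)
  \<comment> \<open>Up to the factor \<open>n\<^sup>2\<close>, which avoids a quotient, this is the
    component of \<open>f\<close> orthogonal to \<open>g\<close>.\<close>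
  have "0 \<le> (L2_norm M (\<lambda>x. of_real (n\<^sup>2) * f x + (- i) * g x))\<^sup>2" by simp
  also have "\<dots> = n\<^sup>2 * (n\<^sup>2 * (L2_norm M f)\<^sup>2 - (cmod i)\<^sup>2)"
    unfolding L2_norm_lincomb_sq[OF assms] i_def[symmetric] n_def[symmetric] cross
      norm_of_real norm_minus_cancel abs_power2
    by (rule collect)
  finally have "0 \<le> n\<^sup>2 * (n\<^sup>2 * (L2_norm M f)\<^sup>2 - (cmod i)\<^sup>2)" .
  moreover have "0 < n\<^sup>2" using False by (simp add: n_def)
  ultimately have "0 \<le> n\<^sup>2 * (L2_norm M f)\<^sup>2 - (cmod i)\<^sup>2"
    unfolding zero_le_mult_iff by linarith
  then have "(cmod i)\<^sup>2 \<le> (n * L2_norm M f)\<^sup>2"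
    by (simp add: power_mult_distrib)
  then have "cmod i \<le> n * L2_norm M f"
    by (rule power2_le_imp_le) (simp add: n_def L2_norm_nonneg)
  then show ?thesis
    by (simp only: i_def n_def mult.commute)
qed

lemma L2_norm_triangle:
  assumes "f \<in> L2 M" "g \<in> L2 M"
  shows "L2_norm M (\<lambda>x. f x + g x) \<le> L2_norm M f + L2_norm M g"
proof (rule power2_le_imp_le)
  have "Re (L2_inner M f g) \<le> L2_norm M f * L2_norm M g"
    using L2_Cauchy_Schwarz[OF assms] complex_Re_le_cmod order_trans by blast
  then show "(L2_norm M (\<lambda>x. f x + g x))\<^sup>2 \<le> (L2_norm M f + L2_norm M g)\<^sup>2"
    using L2_norm_lincomb_sq[OF assms, of 1 1] by (simp add: power2_sum)
qed (simp add: L2_norm_nonneg)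

lemma L2_dist_triangle:
  assumes "f \<in> L2 M" "g \<in> L2 M" "h \<in> L2 M"
  shows "L2_norm M (\<lambda>x. f x - h x) \<le> L2_norm M (\<lambda>x. f x - g x) + L2_norm M (\<lambda>x. g x - h x)"
  using L2_norm_triangle[OF L2_diff[OF assms(1,2)] L2_diff[OF assms(2,3)]] by simp

text \<open>Riesz-Fischer for sequences of geometric speed. The integrable function \<open>G\<close>
  controls all remainders at once, so pointwise convergence and norm convergence come from the same
  weighted series.\<close>

lemma L2_complete:
  assumes f: "\<And>n. f n \<in> L2 M"
    and fast: "\<And>n. L2_norm M (\<lambda>x. f (Suc n) x - f n x) \<le> (1/2)^n"
  shows "\<exists>g\<in>L2 M. (\<lambda>n. L2_norm M (\<lambda>x. g x - f n x)) \<longlonglongrightarrow> 0"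
proof -
  have [measurable]: "f n \<in> borel_measurable M" for n
    using f by (rule L2_measurable)
  define u where "u = (\<lambda>n x. cmod (f (Suc n) x - f n x))"
  \<comment> \<open>The increments have squared norm at most 4^-n, so the weight 2^n still leaves
    summable integrals; the same weight is what allows a return from squares to the increments
    themselves.\<close>
  define v where "v = (\<lambda>n x. 2^n * (u n x)\<^sup>2)"
  define G where "G = (\<lambda>x. \<Sum>n. v n x)"
  \<comment> \<open>\<open>lim\<close> yields a measurable function on the whole space; the points
    of divergence, where its value is arbitrary, form part of a null set.\<close>
  define g where "g = (\<lambda>x. lim (\<lambda>n. f n x))"
  have v_nonneg: "0 \<le> v n x" for n x by (simp add: v_def)
  have int_v: "integrable M (v n)" for n
    unfolding v_def u_def by (intro integrable_mult_right L2_integrable L2_diff f)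
  have v_le: "(LINT x|M. v n x) \<le> (1/2)^n" for n
  proof -
    have "(LINT x|M. v n x) = 2^n * (L2_norm M (\<lambda>x. f (Suc n) x - f n x))\<^sup>2"
      by (simp add: v_def u_def L2_norm_sq)
    also have "\<dots> \<le> 2^n * ((1/2)^n)\<^sup>2"
      by (intro mult_left_mono power_mono fast L2_norm_nonneg) auto
    also have "\<dots> = (1/2)^n"
      by (simp add: power2_eq_square power_divide)
    finally show ?thesis .
  qed
  have geometric: "summable (\<lambda>n. (1/2)^n :: real)"
    by (rule summable_geometric) simp
  have summable_int: "summable (\<lambda>n. LINT x|M. norm (v n x))"
    by (rule summable_comparison_test[OF _ geometric])
      (use v_le v_nonneg in \<open>auto simp: integral_nonneg_AE\<close>)
  have AE_summable: "AE x in M. summable (\<lambda>n. v n x)"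
  proof -
    have "(\<integral>\<^sup>+x. (\<Sum>n. ennreal (v n x)) \<partial>M) = (\<Sum>n. \<integral>\<^sup>+x. ennreal (v n x) \<partial>M)"
      using int_v by (intro nn_integral_suminf) auto
    also have "\<dots> = (\<Sum>n. ennreal (LINT x|M. v n x))"
      using int_v v_nonneg by (simp add: nn_integral_eq_integral)
    also have "\<dots> < \<infinity>"
      using summable_int v_nonneg
      by (simp add: ennreal_suminf_neq_top less_top[symmetric] integral_nonneg_AE)
    finally have "AE x in M. (\<Sum>n. ennreal (v n x)) \<noteq> \<infinity>"
      using int_v by (intro nn_integral_noteq_infinite) auto
    then show ?thesis
      by eventually_elim (use v_nonneg summable_suminf_not_top in auto)
  qed
  have int_G: "integrable M G"
    unfolding G_def using AE_summable v_nonneg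
    by (intro integrable_suminf int_v summable_int) simp
  have AE_bound: "AE x in M. \<forall>n. (cmod (g x - f n x))\<^sup>2 \<le> 2 * (1/2)^n * G x"
    using AE_summable
  proof eventually_elim
    case (elim x)
    have "u n x \<le> (1/2)^n + v n x" for n
    proof -
      \<comment> \<open>The inequality of arithmetic and geometric means bounds \<open>u n x\<close>
        by two summable terms.\<close>
      have "0 \<le> ((1/2)^n - u n x)\<^sup>2 * 2^n" by simp
      also have "\<dots> = (1/2)^n - 2 * u n x + v n x"
        by (simp add: v_def power2_diff power2_eq_square power_divide field_simps)
      finally have "2 * u n x \<le> (1/2)^n + v n x" by simp
      moreover have "0 \<le> u n x" by (simp add: u_def)
      ultimately show ?thesis by linarith
    qed
    then have "summable (\<lambda>n. u n x)"
      by (intro summable_comparison_test[OF _ summable_add[OF geometric elim]])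
        (auto simp: u_def)
    then have "summable (\<lambda>n. f (Suc n) x - f n x)"
      unfolding u_def by (rule summable_norm_cancel)
    then have "(\<lambda>n. \<Sum>k<n. f (Suc k) x - f k x) \<longlonglongrightarrow> (\<Sum>k. f (Suc k) x - f k x)"
      by (rule summable_LIMSEQ)
    then have "(\<lambda>n. (\<Sum>k<n. f (Suc k) x - f k x) + f 0 x) \<longlonglongrightarrow> (\<Sum>k. f (Suc k) x - f k x) + f 0 x"
      by (intro tendsto_intros)
    then have "convergent (\<lambda>n. f n x)"
      unfolding sum_lessThan_telescope[of "\<lambda>k. f k x"] by (auto simp: convergent_def)
    then have lim: "(\<lambda>n. f n x) \<longlonglongrightarrow> g x"
      unfolding g_def by (simp add: convergent_LIMSEQ_iff)
    have bound: "(cmod (f m x - f n x))\<^sup>2 \<le> 2 * (1/2)^n * G x" if "n \<le> m" for n m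
    proof -
      have "f m x - f n x = (\<Sum>k=n..<m. f (Suc k) x - f k x)"
        using sum_Suc_diff'[OF that, of "\<lambda>k. f k x"] by simp
      then have "cmod (f m x - f n x) \<le> (\<Sum>k=n..<m. u k x)"
        unfolding u_def by (metis norm_sum)
      then have "(cmod (f m x - f n x))\<^sup>2 \<le> (\<Sum>k=n..<m. u k x)\<^sup>2"
        by (intro power_mono) auto
      \<comment> \<open>Splitting off the weight prepares Cauchy-Schwarz: one factor becomes a
        geometric tail, at most \<open>2 * (1/2)^n\<close>, the other a partial sum of
        \<open>G x\<close>.\<close>
      also have "\<dots> = (\<Sum>k=n..<m. sqrt ((1/2)^k) * (sqrt (2^k) * u k x))\<^sup>2"
        by (simp add: mult.assoc[symmetric] real_sqrt_mult[symmetric] power_divide)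
      also have "\<dots> \<le> (\<Sum>k=n..<m. (sqrt ((1/2)^k))\<^sup>2) * (\<Sum>k=n..<m. (sqrt (2^k) * u k x)\<^sup>2)"
        by (rule Cauchy_Schwarz_ineq_sum)
      also have "\<dots> = (\<Sum>k=n..<m. (1/2)^k) * (\<Sum>k=n..<m. v k x)"
        by (simp add: v_def power_mult_distrib)
      also have "\<dots> \<le> (2 * (1/2)^n) * G x"
      proof (intro mult_mono)
        have "(\<Sum>k=n..<m. (1/2::real)^k) = 2 * (1/2)^n - 2 * (1/2)^m"
          using that by (induction m rule: dec_induct) auto
        then show "(\<Sum>k=n..<m. (1/2::real)^k) \<le> 2 * (1/2)^n" by simp
        show "(\<Sum>k=n..<m. v k x) \<le> G x"
          unfolding G_def using v_nonneg by (intro sum_le_suminf elim) auto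
      qed (auto intro: sum_nonneg v_nonneg)
      finally show ?thesis .
    qed
    show ?case
    proof
      fix n
      have "(\<lambda>m. (cmod (f m x - f n x))\<^sup>2) \<longlonglongrightarrow> (cmod (g x - f n x))\<^sup>2"
        by (intro tendsto_intros lim)
      then show "(cmod (g x - f n x))\<^sup>2 \<le> 2 * (1/2)^n * G x"
        by (rule LIMSEQ_le_const2) (use bound in blast)
    qed
  qed
  have [measurable]: "g \<in> borel_measurable M"
    unfolding g_def by measurable
  have diff: "(\<lambda>x. g x - f n x) \<in> L2 M" for n
    by (rule L2_dominated[of _ _ "\<lambda>x. 2 * (1/2)^n * G x"])
      (use AE_bound int_G in auto)
  have "g \<in> L2 M"
    using L2_add[OF diff f, of 0 0] by simp
  moreover have "(\<lambda>n. L2_norm M (\<lambda>x. g x - f n x)) \<longlonglongrightarrow> 0"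
  proof -
    have "(L2_norm M (\<lambda>x. g x - f n x))\<^sup>2 \<le> 2 * (1/2)^n * (LINT x|M. G x)" for n
    proof -
      have "(L2_norm M (\<lambda>x. g x - f n x))\<^sup>2 \<le> (LINT x|M. 2 * (1/2)^n * G x)"
        unfolding L2_norm_sq using AE_bound
        by (intro integral_mono_AE L2_integrable diff integrable_mult_right int_G) auto
      then show ?thesis by (simp only: integral_mult_right_zero)
    qed
    then have le: "(L2_norm M (\<lambda>x. g x - f n x))\<^sup>2 \<le> 2 * (LINT x|M. G x) * (1/2)^n" for n
      by (simp only: mult_ac)
    have "(\<lambda>n. (1/2::real)^n) \<longlonglongrightarrow> 0"
      by (rule LIMSEQ_power_zero) simp
    then have "(\<lambda>n. 2 * (LINT x|M. G x) * (1/2)^n) \<longlonglongrightarrow> 0"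
      by (rule tendsto_mult_right_zero)
    then have "(\<lambda>n. (L2_norm M (\<lambda>x. g x - f n x))\<^sup>2) \<longlonglongrightarrow> 0"
      by (rule Lim_null_comparison[rotated]) (use le in auto)
    then show ?thesis by simp
  qed
  ultimately show ?thesis by blast
qed

section \<open>Closed subspaces\<close>

text \<open>The closure is taken for the seminorm on functions, so such a set automatically contains
  every representative of each of its elements (\<open>L2_closed_subspace_AE\<close>).\<close>

definition L2_closed_subspace :: "'a measure \<Rightarrow> ('a \<Rightarrow> complex) set \<Rightarrow> bool" where
  "L2_closed_subspace M D \<longleftrightarrow> D \<subseteq> L2 M \<and> D \<noteq> {} \<and>
     (\<forall>f\<in>D. \<forall>g\<in>D. \<forall>a b. (\<lambda>x. a * f x + b * g x) \<in> D) \<and> L2_closure M D \<subseteq> D"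

context
  fixes M :: "'a measure" and D
  assumes D: "L2_closed_subspace M D"
begin

lemma L2_closed_subspace_subset: "f \<in> D \<Longrightarrow> f \<in> L2 M"
  using D by (auto simp: L2_closed_subspace_def)

lemma L2_closed_subspace_lincomb: "f \<in> D \<Longrightarrow> g \<in> D \<Longrightarrow> (\<lambda>x. a * f x + b * g x) \<in> D"
  using D by (auto simp: L2_closed_subspace_def)

lemma L2_closed_subspace_0: "(\<lambda>x. 0) \<in> D"
proof -
  obtain f where "f \<in> D" using D by (auto simp: L2_closed_subspace_def)
  from L2_closed_subspace_lincomb[OF this this, of 0 0] show ?thesis by simp
qed

lemma L2_closed_subspace_cmult: "f \<in> D \<Longrightarrow> (\<lambda>x. c * f x) \<in> D"
  using L2_closed_subspace_lincomb[of f f c 0] by simp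

lemma L2_closed_subspace_add: "f \<in> D \<Longrightarrow> g \<in> D \<Longrightarrow> (\<lambda>x. f x + g x) \<in> D"
  using L2_closed_subspace_lincomb[of f g 1 1] by simp

lemma L2_closed_subspace_diff: "f \<in> D \<Longrightarrow> g \<in> D \<Longrightarrow> (\<lambda>x. f x - g x) \<in> D"
  using L2_closed_subspace_lincomb[of f g 1 "-1"] by simp

lemma L2_closed_subspace_sum:
  "(\<And>i. i \<in> F \<Longrightarrow> f i \<in> D) \<Longrightarrow> (\<lambda>x. \<Sum>i\<in>F. f i x) \<in> D"
  by (induction F rule: infinite_finite_induct)
    (simp_all add: L2_closed_subspace_0 L2_closed_subspace_add)

lemma L2_closed_subspace_limit:
  assumes "f \<in> L2 M" "\<And>n. s n \<in> D" "(\<lambda>n::nat. L2_norm M (\<lambda>x. f x - s n x)) \<longlonglongrightarrow> 0"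
  shows "f \<in> D"
proof -
  have "\<exists>g\<in>D. L2_norm M (\<lambda>x. f x - g x) < e" if "e > 0" for e
    using order_tendstoD(2)[OF assms(3) that] assms(2) by (meson eventually_happens' sequentially_bot)
  then have "f \<in> L2_closure M D" using assms(1) by (simp add: L2_closure_def)
  then show ?thesis using D by (auto simp: L2_closed_subspace_def)
qed

lemma L2_closed_subspace_AE:
  assumes "f \<in> L2 M" "g \<in> D" "AE x in M. f x = g x"
  shows "f \<in> D"
proof (rule L2_closed_subspace_limit[OF assms(1)])
  show "(\<lambda>n. L2_norm M (\<lambda>x. f x - g x)) \<longlonglongrightarrow> 0"
    using assms L2_norm_eq_0_iff[OF L2_diff[OF assms(1) L2_closed_subspace_subset[OF assms(2)]]]
    by simp
qed (rule assms)

text \<open>Norm closedness is traded for closedness under dominated pointwise limits, the form in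
  which approximation by sets and simple functions can run inside \<open>D\<close>. The limit
  inherits the bound \<open>w\<close>, so the squared differences are dominated by
  \<open>4 * w\<close>.\<close>

lemma L2_closed_subspace_dominated:
  assumes f[measurable]: "f \<in> borel_measurable M" and s: "\<And>n::nat. s n \<in> D"
    and lim: "AE x in M. (\<lambda>n. s n x) \<longlonglongrightarrow> f x"
    and w: "integrable M w" "\<And>n. AE x in M. (cmod (s n x))\<^sup>2 \<le> w x"
  shows "f \<in> D"
proof (rule L2_closed_subspace_limit[OF _ s])
  have [measurable]: "s n \<in> borel_measurable M" for n
    using s L2_closed_subspace_subset L2_measurable by blast
  have w_all: "AE x in M. \<forall>n. (cmod (s n x))\<^sup>2 \<le> w x"
    using w(2) by (simp add: AE_all_countable)
  have le: "AE x in M. (cmod (f x))\<^sup>2 \<le> w x"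
    using w_all lim
  proof eventually_elim
    case (elim x)
    have "(\<lambda>n. (cmod (s n x))\<^sup>2) \<longlonglongrightarrow> (cmod (f x))\<^sup>2"
      by (intro tendsto_intros elim)
    then show ?case by (rule LIMSEQ_le_const2) (use elim in auto)
  qed
  then show "f \<in> L2 M" by (rule L2_dominated[OF f w(1)])
  have "(\<lambda>n. LINT x|M. (cmod (f x - s n x))\<^sup>2) \<longlonglongrightarrow> (LINT x|M. 0)"
  proof (rule integral_dominated_convergence)
    show "integrable M (\<lambda>x. 4 * w x)" using w(1) by simp
    show "AE x in M. (\<lambda>n. (cmod (f x - s n x))\<^sup>2) \<longlonglongrightarrow> 0"
      using lim
    proof eventually_elim
      case (elim x)
      have "(\<lambda>n. (cmod (f x - s n x))\<^sup>2) \<longlonglongrightarrow> (cmod (f x - f x))\<^sup>2"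
        by (intro tendsto_intros elim)
      then show ?case by simp
    qed
    fix n
    show "AE x in M. norm ((cmod (f x - s n x))\<^sup>2) \<le> 4 * w x"
      using le w(2)[of n]
    proof eventually_elim
      case (elim x)
      have "(cmod (f x - s n x))\<^sup>2 \<le> (cmod (f x) + cmod (s n x))\<^sup>2"
        by (intro power_mono norm_triangle_ineq4) simp
      also have "\<dots> \<le> 2 * (cmod (f x))\<^sup>2 + 2 * (cmod (s n x))\<^sup>2"
        using zero_le_power2[of "cmod (f x) - cmod (s n x)"]
        by (simp add: power2_eq_square algebra_simps)
      finally show ?case using elim by simp
    qed
  qed measurable
  then show "(\<lambda>n. L2_norm M (\<lambda>x. f x - s n x)) \<longlonglongrightarrow> 0"
    unfolding L2_norm_def using tendsto_real_sqrt by fastforce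
qed

text \<open>Dynkin's argument, localized to a generator \<open>C\<close>: on a space of infinite
  measure the complement of a set may have no square-integrable indicator, but its part in
  \<open>C\<close> does. The indicator of \<open>C\<close> is also the dominating function for
  disjoint unions.\<close>

lemma L2_closed_subspace_indicator:
  assumes E: "Int_stable E" "E \<subseteq> Pow (space M)" "sets M = sigma_sets (space M) E"
    and ind: "\<And>A. A \<in> E \<Longrightarrow> indicator A \<in> D"
    and C: "C \<in> E" and A: "A \<in> sets M"
  shows "indicator (A \<inter> C) \<in> D"
proof -
  have "A \<in> sigma_sets (space M) E" using A E by simp
  from E(1,2) this show ?thesis
  proof (induction rule: sigma_sets_induct_disjoint)
    case (basic A)
    then show ?case using C E(1) ind by (simp add: Int_stable_def)
  next
    case empty
    then show ?case using L2_closed_subspace_0 by (simp add: fun_eq_iff[symmetric] indicator_def[abs_def])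
  next
    case (compl A)
    have "(\<lambda>x. indicator C x - indicator (A \<inter> C) x :: complex) \<in> D"
      by (intro L2_closed_subspace_diff ind C compl)
    also have "(\<lambda>x. indicator C x - indicator (A \<inter> C) x :: complex) = indicator ((space M - A) \<inter> C)"
      using C E(2) by (auto simp: fun_eq_iff indicator_def)
    finally show ?case .
  next
    case (union A)
    have C_L2: "indicator C \<in> L2 M"
      using ind[OF C] by (rule L2_closed_subspace_subset)
    show ?case
    proof (rule L2_closed_subspace_dominated)
      have "A i \<in> sets M" for i using union E(3) by auto
      moreover have "C \<in> sets M" using C by (simp add: E(3))
      ultimately have "(\<Union>i. A i) \<inter> C \<in> sets M" by blast
      then show "indicator (\<Union> (range A) \<inter> C) \<in> borel_measurable M" by simp
      show "(\<lambda>x. \<Sum>i<n. indicator (A i \<inter> C) x) \<in> D" for n :: nat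
        by (intro L2_closed_subspace_sum union)
      have sum_eq: "(\<Sum>i<n. indicator (A i \<inter> C) x :: complex) = indicator (\<Union>i<n. A i \<inter> C) x" for n x
        using union(1)
        by (intro indicator_UN_disjoint[symmetric]) (auto simp: disjoint_family_on_def)
      show "AE x in M. (\<lambda>n. \<Sum>i<n. indicator (A i \<inter> C) x :: complex) \<longlonglongrightarrow> indicator (\<Union> (range A) \<inter> C) x"
        unfolding sum_eq UN_extend_simps(4) by (intro AE_I2 LIMSEQ_indicator_UN)
      show "integrable M (\<lambda>x. (cmod (indicator C x))\<^sup>2)"
        by (rule L2_integrable[OF C_L2])
      show "AE x in M. (cmod (\<Sum>i<n. indicator (A i \<inter> C) x))\<^sup>2 \<le> (cmod (indicator C x))\<^sup>2" for n
        unfolding sum_eq by (auto simp: indicator_def)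
    qed
  qed
qed

lemma L2_closed_subspace_eq_L2:
  fixes C :: "nat \<Rightarrow> 'a set"
  assumes E: "Int_stable E" "E \<subseteq> Pow (space M)" "sets M = sigma_sets (space M) E"
    and ind: "\<And>A. A \<in> E \<Longrightarrow> indicator A \<in> D"
    and C: "range C \<subseteq> E" "incseq C" "(\<Union>n. C n) = space M"
  shows "D = L2 M"
proof (intro equalityI subsetI)
  fix f assume f: "f \<in> L2 M"
  have [measurable]: "C n \<in> sets M" for n using C(1) E(3) by auto
  have [measurable]: "f \<in> borel_measurable M" using f by (rule L2_measurable)
  from borel_measurable_implies_sequence_metric[OF this, of 0] obtain s where
    s: "\<And>i. simple_function M (s i)" and lim: "\<And>x. x \<in> space M \<Longrightarrow> (\<lambda>i. s i x) \<longlonglongrightarrow> f x"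
    and le: "\<And>i x. x \<in> space M \<Longrightarrow> cmod (s i x) \<le> 2 * cmod (f x)"
    unfolding dist_0_norm dist_norm diff_zero by blast
  \<comment> \<open>The simple function \<open>s n\<close> cut off to \<open>C n\<close>, written as
    a combination of indicators already known to be in \<open>D\<close>.\<close>
  define t where "t = (\<lambda>n x. \<Sum>y\<in>s n ` space M. y * indicator ((s n -` {y} \<inter> space M) \<inter> C n) x)"
  have t_eq: "t n x = s n x * indicator (C n) x" if x: "x \<in> space M" for n x
  proof -
    have fin: "finite (s n ` space M)" using s by (rule simple_functionD)
    have "t n x = (\<Sum>y\<in>s n ` space M. if s n x = y then y * indicator (C n) x else 0)"
      unfolding t_def by (intro sum.cong) (auto simp: indicator_def x)
    then show ?thesis using fin x by simp
  qed
  show "f \<in> D"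
  proof (rule L2_closed_subspace_dominated)
    show "t n \<in> D" for n
      unfolding t_def using C(1) simple_functionD(2)[OF s]
      by (intro L2_closed_subspace_sum L2_closed_subspace_cmult L2_closed_subspace_indicator[OF E ind])
        auto
    show "AE x in M. (\<lambda>n. t n x) \<longlonglongrightarrow> f x"
    proof (rule AE_I2)
      fix x assume x: "x \<in> space M"
      then have "(\<lambda>n. s n x * indicator (C n) x) \<longlonglongrightarrow> f x * indicator (\<Union>n. C n) x"
        by (intro tendsto_mult lim LIMSEQ_indicator_incseq C(2))
      then show "(\<lambda>n. t n x) \<longlonglongrightarrow> f x"
        using x C(3) by (simp add: t_eq)
    qed
    show "integrable M (\<lambda>x. 4 * (cmod (f x))\<^sup>2)"
      using L2_integrable[OF f] by simp
    show "AE x in M. (cmod (t n x))\<^sup>2 \<le> 4 * (cmod (f x))\<^sup>2" for n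
    proof (rule AE_I2)
      fix x assume x: "x \<in> space M"
      have "(cmod (t n x))\<^sup>2 \<le> (2 * cmod (f x))\<^sup>2"
        using le[OF x, of n] by (intro power_mono) (auto simp: t_eq[OF x] indicator_def)
      then show "(cmod (t n x))\<^sup>2 \<le> 4 * (cmod (f x))\<^sup>2" by (simp add: power_mult_distrib)
    qed
  qed fact
qed (rule L2_closed_subspace_subset)

end

section \<open>Linear spans, their closures and orthogonality\<close>

lemma fun_span_base: "f \<in> A \<Longrightarrow> f \<in> fun_span A"
  unfolding fun_span_def by (auto intro!: exI[of _ "{f}"] exI[of _ "\<lambda>_. 1"])

lemma fun_span_0: "(\<lambda>x. 0) \<in> fun_span A"
  unfolding fun_span_def by (auto intro!: exI[of _ "{}"])

lemma fun_span_lincomb: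
  assumes "f \<in> fun_span A" "g \<in> fun_span A"
  shows "(\<lambda>x. a * f x + b * g x) \<in> fun_span A"
proof -
  obtain B c where B: "finite B" "B \<subseteq> A" "f = (\<lambda>x. \<Sum>h\<in>B. c h * h x)"
    using assms(1) by (auto simp: fun_span_def)
  obtain B' c' where B': "finite B'" "B' \<subseteq> A" "g = (\<lambda>x. \<Sum>h\<in>B'. c' h * h x)"
    using assms(2) by (auto simp: fun_span_def)
  define d where "d h = a * (if h \<in> B then c h else 0) + b * (if h \<in> B' then c' h else 0)" for h
  have "a * f x + b * g x = (\<Sum>h\<in>B \<union> B'. d h * h x)" for x
  proof -
    have "f x = (\<Sum>h\<in>B \<union> B'. (if h \<in> B then c h else 0) * h x)"
      unfolding B(3) using B(1) B'(1) by (intro sum.mono_neutral_cong_left) auto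
    moreover have "g x = (\<Sum>h\<in>B \<union> B'. (if h \<in> B' then c' h else 0) * h x)"
      unfolding B'(3) using B(1) B'(1) by (intro sum.mono_neutral_cong_left) auto
    ultimately show ?thesis
      by (simp only: d_def distrib_right sum.distrib sum_distrib_left mult.assoc)
  qed
  then show ?thesis
    using B(1,2) B'(1,2) unfolding fun_span_def by (auto intro!: exI[of _ "B \<union> B'"] exI[of _ d])
qed

lemma fun_span_L2: "A \<subseteq> L2 M \<Longrightarrow> fun_span A \<subseteq> L2 M"
  unfolding fun_span_def by (auto intro!: L2_sum L2_cmult)

lemma L2_closure_subset: "A \<subseteq> L2 M \<Longrightarrow> A \<subseteq> L2_closure M A"
  unfolding L2_closure_def by (auto simp: L2_norm_def intro!: bexI[rotated])

lemma L2_norm_lincomb_diff_le: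
  assumes "f \<in> L2 M" "f' \<in> L2 M" "g \<in> L2 M" "g' \<in> L2 M"
  shows "L2_norm M (\<lambda>x. (a * f x + b * g x) - (a * f' x + b * g' x))
    \<le> cmod a * L2_norm M (\<lambda>x. f x - f' x) + cmod b * L2_norm M (\<lambda>x. g x - g' x)"
proof -
  have "L2_norm M (\<lambda>x. (a * f x + b * g x) - (a * f' x + b * g' x))
      = L2_norm M (\<lambda>x. a * (f x - f' x) + b * (g x - g' x))"
    by (rule arg_cong[of _ _ "L2_norm M"]) (simp add: algebra_simps)
  also have "\<dots> \<le> L2_norm M (\<lambda>x. a * (f x - f' x)) + L2_norm M (\<lambda>x. b * (g x - g' x))"
    using assms by (intro L2_norm_triangle L2_cmult L2_diff)
  finally show ?thesis by (simp add: L2_norm_cmult)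
qed

lemma L2_closed_subspace_closure_span:
  assumes A: "A \<subseteq> L2 M"
  shows "L2_closed_subspace M (L2_closure M (fun_span A))"
proof -
  let ?V = "L2_closure M (fun_span A)"
  note span = fun_span_L2[OF A]
  have "(\<lambda>x. a * f x + b * g x) \<in> ?V" if f: "f \<in> ?V" and g: "g \<in> ?V" for f g a b
  proof -
    have "\<exists>h\<in>fun_span A. L2_norm M (\<lambda>x. (a * f x + b * g x) - h x) < e" if "e > 0" for e
    proof -
      \<comment> \<open>The summand 1 keeps the divisor positive when both coefficients
        vanish.\<close>
      define d where "d = e / (cmod a + cmod b + 1)"
      have pos: "cmod a + cmod b + 1 > 0" by (simp add: add_nonneg_pos)
      then have d: "d > 0" using that by (simp add: d_def)
      obtain f' where f': "f' \<in> fun_span A" "L2_norm M (\<lambda>x. f x - f' x) < d"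
        using f d by (auto simp: L2_closure_def)
      obtain g' where g': "g' \<in> fun_span A" "L2_norm M (\<lambda>x. g x - g' x) < d"
        using g d by (auto simp: L2_closure_def)
      have "L2_norm M (\<lambda>x. (a * f x + b * g x) - (a * f' x + b * g' x))
          \<le> cmod a * L2_norm M (\<lambda>x. f x - f' x) + cmod b * L2_norm M (\<lambda>x. g x - g' x)"
        using f g f'(1) g'(1) span by (intro L2_norm_lincomb_diff_le) (auto simp: L2_closure_def)
      also have "\<dots> \<le> cmod a * d + cmod b * d"
        using f'(2) g'(2) by (intro add_mono mult_left_mono) auto
      also have "\<dots> < (cmod a + cmod b + 1) * d"
        using d by (simp add: distrib_right)
      also have "\<dots> = e" using pos by (simp add: d_def)
      finally show ?thesis
        by (intro bexI[of _ "\<lambda>x. a * f' x + b * g' x"] fun_span_lincomb f'(1) g'(1))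
    qed
    then show ?thesis using f g by (auto simp: L2_closure_def intro: L2_lincomb)
  qed
  moreover have "L2_closure M ?V \<subseteq> ?V"
  proof
    fix f assume f: "f \<in> L2_closure M ?V"
    have "\<exists>h\<in>fun_span A. L2_norm M (\<lambda>x. f x - h x) < e" if e: "e > 0" for e
    proof -
      obtain g where g: "g \<in> ?V" "L2_norm M (\<lambda>x. f x - g x) < e / 2"
        using f half_gt_zero[OF e] unfolding L2_closure_def[of M ?V] by blast
      then obtain h where h: "h \<in> fun_span A" "L2_norm M (\<lambda>x. g x - h x) < e / 2"
        using half_gt_zero[OF e] unfolding L2_closure_def by blast
      have "L2_norm M (\<lambda>x. f x - h x) \<le> L2_norm M (\<lambda>x. f x - g x) + L2_norm M (\<lambda>x. g x - h x)"
        using f g(1) h(1) span by (intro L2_dist_triangle) (auto simp: L2_closure_def)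
      then show ?thesis using g(2) h by force
    qed
    then show "f \<in> ?V" using f by (auto simp: L2_closure_def)
  qed
  moreover have "?V \<noteq> {}"
    using L2_closure_subset[OF span] fun_span_0 by blast
  ultimately show ?thesis
    by (auto simp: L2_closed_subspace_def L2_closure_def)
qed

lemma L2_closure_mono: "A \<subseteq> B \<Longrightarrow> L2_closure M A \<subseteq> L2_closure M B"
  unfolding L2_closure_def by blast

lemma L2_closure_span_least:
  assumes D: "L2_closed_subspace M D" and A: "A \<subseteq> D"
  shows "L2_closure M (fun_span A) \<subseteq> D"
proof -
  have "fun_span A \<subseteq> D"
    unfolding fun_span_def using A
    by (auto intro!: L2_closed_subspace_sum[OF D] L2_closed_subspace_cmult[OF D])
  then show ?thesis
    using L2_closure_mono D unfolding L2_closed_subspace_def by blast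
qed

text \<open>By Cauchy-Schwarz, inner products that agree on arbitrarily close approximants agree in
  the limit. Two spaces are allowed because the approximants will be partners under an
  isometry.\<close>

lemma L2_inner_limit_eq:
  assumes "f \<in> L2 M" "f' \<in> L2 M" "h \<in> L2 N" "h' \<in> L2 N"
    and lim: "\<And>e. e > 0 \<Longrightarrow> \<exists>g\<in>L2 M. \<exists>j\<in>L2 N. L2_inner M g f' = L2_inner N j h' \<and>
      L2_norm M (\<lambda>x. f x - g x) < e \<and> L2_norm N (\<lambda>x. h x - j x) < e"
  shows "L2_inner M f f' = L2_inner N h h'"
proof -
  define C where "C = L2_norm M f' + L2_norm N h' + 1"
  have C: "C > 0" by (simp add: C_def L2_norm_nonneg add_nonneg_pos)
  have le: "cmod (L2_inner M f f' - L2_inner N h h') \<le> e" if e: "e > 0" for e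
  proof -
    define d where "d = e / C"
    have d: "d > 0" and dC: "d * C = e" using e C by (simp_all add: d_def)
    from lim[OF d] obtain g j where g: "g \<in> L2 M" "L2_norm M (\<lambda>x. f x - g x) < d"
      and j: "j \<in> L2 N" "L2_norm N (\<lambda>x. h x - j x) < d"
      and eq: "L2_inner M g f' = L2_inner N j h'" by blast
    have 1: "L2_inner M (\<lambda>x. f x - g x) f' = L2_inner M f f' - L2_inner M g f'"
      using L2_inner_lincomb_left[OF assms(1) g(1) assms(2), of 1 "-1"] by simp
    have 2: "L2_inner N (\<lambda>x. h x - j x) h' = L2_inner N h h' - L2_inner N j h'"
      using L2_inner_lincomb_left[OF assms(3) j(1) assms(4), of 1 "-1"] by simp
    have "L2_inner M f f' - L2_inner N h h'
        = L2_inner M (\<lambda>x. f x - g x) f' - L2_inner N (\<lambda>x. h x - j x) h'"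
      using eq 1 2 by simp
    then have "cmod (L2_inner M f f' - L2_inner N h h')
        \<le> cmod (L2_inner M (\<lambda>x. f x - g x) f') + cmod (L2_inner N (\<lambda>x. h x - j x) h')"
      by (simp only: norm_triangle_ineq4)
    also have "\<dots> \<le> L2_norm M (\<lambda>x. f x - g x) * L2_norm M f' + L2_norm N (\<lambda>x. h x - j x) * L2_norm N h'"
      by (intro add_mono L2_Cauchy_Schwarz L2_diff assms g j)
    also have "\<dots> \<le> d * L2_norm M f' + d * L2_norm N h'"
      using g(2) j(2) by (intro add_mono mult_right_mono L2_norm_nonneg) auto
    also have "\<dots> \<le> d * C"
      using d unfolding C_def distrib_left mult_1_right by linarith
    finally show ?thesis unfolding dC .
  qed
  have "cmod (L2_inner M f f' - L2_inner N h h') \<le> 0"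
    by (rule field_le_epsilon) (simp only: add_0 le)
  then show ?thesis by simp
qed

text \<open>Combined with \<open>L2_closure_span_least\<close>, this reduces orthogonality to a
  closed span to orthogonality to its generators.\<close>

lemma L2_closed_subspace_orthogonal:
  assumes g: "g \<in> L2 M"
  shows "L2_closed_subspace M {f \<in> L2 M. L2_inner M f g = 0}" (is "L2_closed_subspace M ?D")
proof -
  have "f \<in> ?D" if "f \<in> L2_closure M ?D" for f
  proof -
    have f: "f \<in> L2 M" using that by (simp add: L2_closure_def)
    \<comment> \<open>Vanishing is phrased as an equality with the inner product of the zero
      function, which serves as its own approximant in \<open>L2_inner_limit_eq\<close>.\<close>
    have "L2_inner M f g = L2_inner M (\<lambda>x. 0) g"
    proof (rule L2_inner_limit_eq[OF f g L2_0 g])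
      fix e :: real assume "e > 0"
      then obtain d where "d \<in> ?D" "L2_norm M (\<lambda>x. f x - d x) < e"
        using \<open>f \<in> L2_closure M ?D\<close> unfolding L2_closure_def by blast
      then show "\<exists>d\<in>L2 M. \<exists>j\<in>L2 M. L2_inner M d g = L2_inner M j g \<and>
          L2_norm M (\<lambda>x. f x - d x) < e \<and> L2_norm M (\<lambda>x. 0 - j x) < e"
        using \<open>e > 0\<close> L2_0[of M]
        by (intro bexI[of _ d] bexI[of _ "\<lambda>x. 0"]) (auto simp: L2_inner_def L2_norm_def)
    qed
    also have "\<dots> = 0" by (simp add: L2_inner_def)
    finally show ?thesis using f by simp
  qed
  moreover have "(\<lambda>x. 0) \<in> ?D" using L2_0[of M] by (simp add: L2_inner_def)
  moreover have "(\<lambda>x. a * f x + b * f' x) \<in> ?D" if "f \<in> ?D" "f' \<in> ?D" for f f' a b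
    using that by (simp add: L2_inner_lincomb_left[OF _ _ g] L2_lincomb)
  ultimately show ?thesis
    unfolding L2_closed_subspace_def by blast
qed

section \<open>Isometries between closed linear spans\<close>

text \<open>Encodes the isometry of the closed linear spans that sends \<open>e k\<close> to \<open>e' k\<close>; as a
  relation it needs no choice of representatives.\<close>

inductive L2_corr ::
  "'a measure \<Rightarrow> 'b measure \<Rightarrow> ('i \<Rightarrow> 'a \<Rightarrow> complex) \<Rightarrow> ('i \<Rightarrow> 'b \<Rightarrow> complex) \<Rightarrow>
   ('a \<Rightarrow> complex) \<Rightarrow> ('b \<Rightarrow> complex) \<Rightarrow> bool"
  for M N e e' where
  generator: "e k \<in> L2 M \<Longrightarrow> e' k \<in> L2 N \<Longrightarrow> L2_corr M N e e' (e k) (e' k)"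
| lincomb: "L2_corr M N e e' f h \<Longrightarrow> L2_corr M N e e' g j \<Longrightarrow>
    L2_corr M N e e' (\<lambda>x. a * f x + b * g x) (\<lambda>x. a * h x + b * j x)"
| limit: "f \<in> L2 M \<Longrightarrow> h \<in> L2 N \<Longrightarrow>
    (\<forall>\<epsilon>>0. \<exists>g j. L2_corr M N e e' g j \<and>
      L2_norm M (\<lambda>x. f x - g x) < \<epsilon> \<and> L2_norm N (\<lambda>x. h x - j x) < \<epsilon>) \<Longrightarrow>
    L2_corr M N e e' f h"

lemma L2_corr_L2: "L2_corr M N e e' f h \<Longrightarrow> f \<in> L2 M \<and> h \<in> L2 N"
  by (induction rule: L2_corr.induct) (auto intro: L2_lincomb)

lemma L2_corr_diff:
  "L2_corr M N e e' f h \<Longrightarrow> L2_corr M N e e' g j \<Longrightarrow>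
    L2_corr M N e e' (\<lambda>x. f x - g x) (\<lambda>x. h x - j x)"
  using L2_corr.lincomb[of M N e e' f h g j 1 "-1"] by simp

text \<open>The pair \<open>f\<^sub>0\<close>, \<open>h\<^sub>0\<close> is any related pair; its
  zero multiple relates the zero functions, which is the value of both sums when \<open>F\<close> is
  empty or infinite.\<close>

lemma L2_corr_sum:
  assumes "L2_corr M N e e' f\<^sub>0 h\<^sub>0" and "\<And>i. i \<in> F \<Longrightarrow> L2_corr M N e e' (f i) (h i)"
  shows "L2_corr M N e e' (\<lambda>x. \<Sum>i\<in>F. c i * f i x) (\<lambda>x. \<Sum>i\<in>F. c i * h i x)"
proof -
  have zero: "L2_corr M N e e' (\<lambda>x. 0) (\<lambda>x. 0)"
    using L2_corr.lincomb[OF assms(1) assms(1), of 0 0] by simp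
  show ?thesis using assms(2)
  proof (induction F rule: infinite_finite_induct)
    case (insert i F)
    then have "L2_corr M N e e' (\<lambda>x. \<Sum>i\<in>F. c i * f i x) (\<lambda>x. \<Sum>i\<in>F. c i * h i x)" by simp
    from L2_corr.lincomb[OF insert.prems[OF insertI1] this, of "c i" 1]
    show ?case using insert.hyps by simp
  qed (simp_all add: zero)
qed

text \<open>The seminorm distance between representatives is zero, so the limit rule applies with
  one and the same approximating pair for every tolerance.\<close>

lemma L2_corr_AE_cong:
  assumes "L2_corr M N e e' f h" "f' \<in> L2 M" "h' \<in> L2 N"
    and "AE x in M. f' x = f x" "AE x in N. h' x = h x"
  shows "L2_corr M N e e' f' h'"
proof (rule L2_corr.limit[OF assms(2,3)], intro allI impI exI conjI)
  have L2: "f \<in> L2 M" "h \<in> L2 N" using L2_corr_L2[OF assms(1)] by auto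
  fix \<epsilon> :: real assume "\<epsilon> > 0"
  then show "L2_norm M (\<lambda>x. f' x - f x) < \<epsilon>" "L2_norm N (\<lambda>x. h' x - h x) < \<epsilon>"
    using L2_norm_eq_0_iff[OF L2_diff[OF assms(2) L2(1)]]
      L2_norm_eq_0_iff[OF L2_diff[OF assms(3) L2(2)]] assms(4,5) by simp_all
qed (rule assms)

lemma L2_corr_range:
  assumes "L2_corr M N e e' f h" and D: "L2_closed_subspace N D" and "\<And>k. e' k \<in> D"
  shows "h \<in> D"
  using assms(1)
proof induction
  case (limit f h)
  then have "h \<in> L2_closure N D" by (fastforce simp: L2_closure_def)
  then show ?case using D by (auto simp: L2_closed_subspace_def)
qed (auto intro: assms L2_closed_subspace_lincomb[OF D])

text \<open>An intertwining relation between two isometric maps needs checking on generators only.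
  Linearity is required as an identity of functions, so that the linear combination rule matches
  literally; norm preservation carries the approximants through the limit rule.\<close>

lemma L2_corr_map:
  assumes "L2_corr M N e e' f h"
    and gen: "\<And>k. L2_corr M N e e' (S (e k)) (U (e' k))"
    and S: "\<And>f g a b. S (\<lambda>x. a * f x + b * g x) = (\<lambda>x. a * S f x + b * S g x)"
      "\<And>f. f \<in> L2 M \<Longrightarrow> S f \<in> L2 M \<and> L2_norm M (S f) = L2_norm M f"
    and U: "\<And>f g a b. U (\<lambda>x. a * f x + b * g x) = (\<lambda>x. a * U f x + b * U g x)"
      "\<And>f. f \<in> L2 N \<Longrightarrow> U f \<in> L2 N \<and> L2_norm N (U f) = L2_norm N f"
  shows "L2_corr M N e e' (S f) (U h)"
  using assms(1)
proof induction
  case (generator k)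
  then show ?case using gen by simp
next
  case (lincomb f h g j a b)
  then show ?case unfolding S U by (intro L2_corr.lincomb)
next
  case (limit f h)
  show ?case
  proof (rule L2_corr.limit)
    show "\<forall>\<epsilon>>0. \<exists>g j. L2_corr M N e e' g j \<and> L2_norm M (\<lambda>x. S f x - g x) < \<epsilon> \<and>
        L2_norm N (\<lambda>x. U h x - j x) < \<epsilon>"
    proof (intro allI impI)
      fix \<epsilon> :: real assume "\<epsilon> > 0"
      with limit(3) obtain g j where gj: "L2_corr M N e e' g j" "L2_corr M N e e' (S g) (U j)"
        "L2_norm M (\<lambda>x. f x - g x) < \<epsilon>" "L2_norm N (\<lambda>x. h x - j x) < \<epsilon>" by blast
      have "L2_norm M (\<lambda>x. S f x - S g x) = L2_norm M (\<lambda>x. f x - g x)"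
        using S(1)[of 1 f "-1" g] S(2)[of "\<lambda>x. f x - g x"] limit(1) L2_corr_L2[OF gj(1)]
        by (simp add: L2_diff)
      moreover have "L2_norm N (\<lambda>x. U h x - U j x) = L2_norm N (\<lambda>x. h x - j x)"
        using U(1)[of 1 h "-1" j] U(2)[of "\<lambda>x. h x - j x"] limit(2) L2_corr_L2[OF gj(1)]
        by (simp add: L2_diff)
      ultimately show "\<exists>g j. L2_corr M N e e' g j \<and> L2_norm M (\<lambda>x. S f x - g x) < \<epsilon> \<and>
        L2_norm N (\<lambda>x. U h x - j x) < \<epsilon>"
        using gj by (intro exI[of _ "S g"] exI[of _ "U j"] conjI) simp_all
    qed
  qed (use limit S(2) U(2) in auto)
qed

text \<open>Both series converge along the same filter of finite index sets, so one finite set makes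
  both partial sums close, and these partial sums are partners.\<close>

lemma L2_corr_has_sum:
  assumes f: "L2_has_sum M (\<lambda>k x. c k * e k x) f UNIV"
    and h: "L2_has_sum N (\<lambda>k x. c k * e' k x) h UNIV"
    and e: "\<And>k. e k \<in> L2 M" "\<And>k. e' k \<in> L2 N"
  shows "L2_corr M N e e' f h"
proof (rule L2_corr.limit)
  show "f \<in> L2 M" "h \<in> L2 N" using f h by (auto simp: L2_has_sum_def)
  show "\<forall>\<epsilon>>0. \<exists>g j. L2_corr M N e e' g j \<and>
      L2_norm M (\<lambda>x. f x - g x) < \<epsilon> \<and> L2_norm N (\<lambda>x. h x - j x) < \<epsilon>"
  proof (intro allI impI)
    fix \<epsilon> :: real assume "\<epsilon> > 0"
    then have "\<forall>\<^sub>F F in finite_subsets_at_top UNIV. L2_norm M (\<lambda>x. f x - (\<Sum>k\<in>F. c k * e k x)) < \<epsilon>"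
      and "\<forall>\<^sub>F F in finite_subsets_at_top UNIV. L2_norm N (\<lambda>x. h x - (\<Sum>k\<in>F. c k * e' k x)) < \<epsilon>"
      using f h unfolding L2_has_sum_def by (auto intro: order_tendstoD)
    from eventually_happens[OF eventually_conj[OF this]] obtain F where
      "L2_norm M (\<lambda>x. f x - (\<Sum>k\<in>F. c k * e k x)) < \<epsilon>"
      "L2_norm N (\<lambda>x. h x - (\<Sum>k\<in>F. c k * e' k x)) < \<epsilon>" by auto
    moreover have "L2_corr M N e e' (\<lambda>x. \<Sum>k\<in>F. c k * e k x) (\<lambda>x. \<Sum>k\<in>F. c k * e' k x)"
      by (rule L2_corr_sum[where f\<^sub>0 = "e undefined" and h\<^sub>0 = "e' undefined"])
        (auto intro: L2_corr.generator e)
    ultimately show "\<exists>g j. L2_corr M N e e' g j \<and>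
      L2_norm M (\<lambda>x. f x - g x) < \<epsilon> \<and> L2_norm N (\<lambda>x. h x - j x) < \<epsilon>" by blast
  qed
qed

context
  fixes M :: "'a measure" and N :: "'b measure" and e :: "'i \<Rightarrow> _" and e' :: "'i \<Rightarrow> _"
  assumes e_L2: "\<And>k. e k \<in> L2 M" "\<And>k. e' k \<in> L2 N"
    and gram: "\<And>k l. L2_inner M (e k) (e l) = L2_inner N (e' k) (e' l)"
begin

lemma L2_corr_inner:
  assumes "L2_corr M N e e' f h" "L2_corr M N e e' g j"
  shows "L2_inner M f g = L2_inner N h j"
proof -
  \<comment> \<open>Induction on one argument with the other held fixed. It is used twice: first
    against a generator, then, after conjugation, against the general second pair.\<close>
  have step: "L2_inner M f g = L2_inner N h j"
    if corr: "L2_corr M N e e' f h" and L2: "g \<in> L2 M" "j \<in> L2 N"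
      and gen: "\<And>k. L2_inner M (e k) g = L2_inner N (e' k) j" for f h g j
    using corr
  proof induction
    case (generator k)
    show ?case by (rule gen)
  next
    case (lincomb f h f' h' a b)
    then show ?case by (simp add: L2_inner_lincomb_left L2 L2_corr_L2)
  next
    case (limit f h)
    show ?case
      by (rule L2_inner_limit_eq[OF limit(1) L2(1) limit(2) L2(2)])
        (use limit(3) L2_corr_L2 in blast)
  qed
  have "L2_inner M (e k) g = L2_inner N (e' k) j" for k
  proof -
    have "L2_inner M g (e k) = L2_inner N j (e' k)"
      by (rule step[OF assms(2) e_L2 gram])
    then show ?thesis by (metis L2_inner_cnj)
  qed
  then show ?thesis
    using L2_corr_L2[OF assms(2)] by (intro step[OF assms(1)]) auto
qed

lemma L2_corr_norm:
  assumes "L2_corr M N e e' f h" shows "L2_norm M f = L2_norm N h"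
proof -
  have "(L2_norm M f)\<^sup>2 = (L2_norm N h)\<^sup>2"
    using L2_corr_inner[OF assms assms] unfolding L2_inner_self of_real_eq_iff .
  then show ?thesis by (rule power2_eq_imp_eq) (rule L2_norm_nonneg)+
qed

text \<open>Equality of norms turns the relation into a well-defined map on classes: a difference of
  norm zero has a partner of norm zero.\<close>

lemma L2_corr_unique:
  assumes "L2_corr M N e e' f h" "L2_corr M N e e' g j" "AE x in M. f x = g x"
  shows "AE x in N. h x = j x"
proof -
  note diff = L2_corr_diff[OF assms(1,2)]
  have "L2_norm M (\<lambda>x. f x - g x) = 0"
    using L2_norm_eq_0_iff[of "\<lambda>x. f x - g x" M] L2_corr_L2[OF diff] assms(3) by simp
  then show ?thesis
    using L2_norm_eq_0_iff[of "\<lambda>x. h x - j x" N] L2_corr_L2[OF diff] L2_corr_norm[OF diff] by simp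
qed

text \<open>An isometry extends to the closure of its domain: partners of a convergent sequence are
  Cauchy, and completeness of the target supplies the limit.\<close>

lemma L2_closed_subspace_corr_domain: "L2_closed_subspace M {f. \<exists>h. L2_corr M N e e' f h}"
  (is "L2_closed_subspace M ?D")
proof -
  have "f \<in> ?D" if f: "f \<in> L2_closure M ?D" for f
  proof -
    have f_L2: "f \<in> L2 M" using f by (simp add: L2_closure_def)
    \<comment> \<open>This closeness puts consecutive partners within \<open>(1/2)^n\<close> of each
      other, the speed that \<open>L2_complete\<close> asks for.\<close>
    have "\<exists>g h. L2_corr M N e e' g h \<and> L2_norm M (\<lambda>x. f x - g x) < (1/2)^n / 4" for n :: nat
    proof -
      have "(0::real) < (1/2)^n / 4" by simp
      then show ?thesis using f unfolding L2_closure_def by blast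
    qed
    then obtain g h where gh: "\<And>n. L2_corr M N e e' (g n) (h n)"
      and close: "\<And>n. L2_norm M (\<lambda>x. f x - g n x) < (1/2)^n / 4" by metis
    have "L2_norm N (\<lambda>x. h (Suc n) x - h n x) \<le> (1/2)^n" for n
    proof -
      have "L2_norm N (\<lambda>x. h (Suc n) x - h n x) = L2_norm M (\<lambda>x. g (Suc n) x - g n x)"
        using L2_corr_norm[OF L2_corr_diff[OF gh gh]] by simp
      also have "\<dots> \<le> L2_norm M (\<lambda>x. g (Suc n) x - f x) + L2_norm M (\<lambda>x. f x - g n x)"
        using gh L2_corr_L2 f_L2 by (intro L2_dist_triangle) blast+
      also have "L2_norm M (\<lambda>x. g (Suc n) x - f x) = L2_norm M (\<lambda>x. f x - g (Suc n) x)"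
        by (rule L2_norm_minus_commute)
      finally have "L2_norm N (\<lambda>x. h (Suc n) x - h n x) \<le> (1/2)^Suc n / 4 + (1/2)^n / 4"
        using close[of "Suc n"] close[of n] by linarith
      moreover have "(0::real) \<le> (1/2)^n" by simp
      ultimately show ?thesis unfolding power_Suc by linarith
    qed
    then obtain k where k: "k \<in> L2 N" "(\<lambda>n. L2_norm N (\<lambda>x. k x - h n x)) \<longlonglongrightarrow> 0"
      using L2_complete[of h N] gh L2_corr_L2 by blast
    have "L2_corr M N e e' f k"
    proof (rule L2_corr.limit[OF f_L2 k(1)], intro allI impI)
      fix \<epsilon> :: real assume "\<epsilon> > 0"
      have "(\<lambda>n. (1/2::real)^n) \<longlonglongrightarrow> 0" by (rule LIMSEQ_power_zero) simp
      then have "\<forall>\<^sub>F n in sequentially. (1/2::real)^n < \<epsilon>"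
        using \<open>\<epsilon> > 0\<close> by (rule order_tendstoD)
      moreover have "\<forall>\<^sub>F n in sequentially. L2_norm N (\<lambda>x. k x - h n x) < \<epsilon>"
        using k(2) \<open>\<epsilon> > 0\<close> by (rule order_tendstoD)
      ultimately have "\<forall>\<^sub>F n in sequentially. (1/2::real)^n < \<epsilon> \<and> L2_norm N (\<lambda>x. k x - h n x) < \<epsilon>"
        by (rule eventually_conj)
      then obtain n where n: "(1/2::real)^n < \<epsilon>" "L2_norm N (\<lambda>x. k x - h n x) < \<epsilon>"
        using eventually_happens'[OF sequentially_bot] by blast
      have "(0::real) \<le> (1/2)^n" by simp
      then have "L2_norm M (\<lambda>x. f x - g n x) < \<epsilon>" using close[of n] n(1) by linarith
      then show "\<exists>g j. L2_corr M N e e' g j \<and> L2_norm M (\<lambda>x. f x - g x) < \<epsilon> \<and>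
          L2_norm N (\<lambda>x. k x - j x) < \<epsilon>"
        using gh n(2) by blast
    qed
    then show ?thesis by blast
  qed
  moreover have "e undefined \<in> ?D"
    using L2_corr.generator[of e _ M e' N, OF e_L2] by blast
  moreover have "(\<lambda>x. a * f x + b * g x) \<in> ?D" if "f \<in> ?D" "g \<in> ?D" for f g a b
    using that L2_corr.lincomb by blast
  ultimately show ?thesis
    using L2_corr_L2 unfolding L2_closed_subspace_def by blast
qed

end

section \<open>The unit circle\<close>

lemma space_circle_haar: "space circle_haar = sphere 0 1"
  by (simp add: circle_haar_def space_restrict_space)

lemma sets_circle_haar: "sets circle_haar = sets (restrict_space borel (sphere 0 1))"
  by (simp add: circle_haar_def)

text \<open>Closed sets are chosen as generators because they are stable under intersection and
  their indicators are bounded limits of continuous functions.\<close>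

lemma sets_circle_haar_closed:
  "sets circle_haar = sigma_sets (sphere 0 1) {F. closed F \<and> F \<subseteq> sphere 0 1}"
proof -
  have "sets circle_haar = (\<inter>) (sphere 0 1) ` sigma_sets UNIV (Collect closed)"
    unfolding sets_circle_haar sets_restrict_space by (simp add: borel_eq_closed)
  also have "\<dots> = sigma_sets (sphere 0 1) ((\<inter>) (sphere 0 1) ` Collect closed)"
  proof (rule sigma_sets_Int)
    show "sphere 0 1 \<in> sigma_sets UNIV (Collect (closed :: complex set \<Rightarrow> bool))"
      by (rule sigma_sets.Basic) simp
  qed simp
  also have "(\<inter>) (sphere 0 1) ` Collect closed = {F. closed F \<and> F \<subseteq> sphere (0::complex) 1}"
    by (auto intro!: closed_Int closed_sphere)
  finally show ?thesis .
qed

lemma borel_measurable_circle: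
  "continuous_on (sphere 0 1) f \<Longrightarrow> sets M = sets circle_haar \<Longrightarrow> f \<in> borel_measurable M"
  unfolding sets_circle_haar
  using borel_measurable_continuous_on_restrict measurable_cong_sets by blast

lemma continuous_on_circle_powi: "continuous_on (sphere 0 1) (\<lambda>z::complex. z powi k)"
  by (intro continuous_intros) auto

section \<open>Trigonometric polynomials and approximation on the circle\<close>

inductive trig_poly :: "(complex \<Rightarrow> complex) \<Rightarrow> bool" where
  powi: "trig_poly (\<lambda>z. z powi k)"
| lincomb: "trig_poly f \<Longrightarrow> trig_poly g \<Longrightarrow> trig_poly (\<lambda>z. a * f z + b * g z)"

lemma trig_poly_cmult: "trig_poly f \<Longrightarrow> trig_poly (\<lambda>z. c * f z)"
  using trig_poly.lincomb[of f f c 0] by simp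

text \<open>The agreement is confined to the circle because adding exponents fails at 0, for example
  for the exponents 1 and -1.\<close>

lemma trig_poly_mult:
  assumes "trig_poly f" "trig_poly g"
  shows "\<exists>h. trig_poly h \<and> (\<forall>z\<in>sphere 0 1. h z = f z * g z)"
  using assms(1)
proof induction
  case (powi k)
  show ?case using assms(2)
  proof induction
    case (powi l)
    show ?case
      by (intro exI[of _ "\<lambda>z. z powi (k + l)"] conjI trig_poly.powi ballI power_int_add) auto
  next
    case (lincomb f g a b)
    then obtain f' g' where "trig_poly f'" "\<forall>z\<in>sphere 0 1. f' z = z powi k * f z"
      "trig_poly g'" "\<forall>z\<in>sphere 0 1. g' z = z powi k * g z" by blast
    then show ?case
      by (intro exI[of _ "\<lambda>z. a * f' z + b * g' z"])
        (simp add: trig_poly.lincomb distrib_left mult.left_commute)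
  qed
next
  case (lincomb f f' a b)
  then obtain h h' where "trig_poly h" "\<forall>z\<in>sphere 0 1. h z = f z * g z"
    "trig_poly h'" "\<forall>z\<in>sphere 0 1. h' z = f' z * g z" by blast
  then show ?case
    by (intro exI[of _ "\<lambda>z. a * h z + b * h' z"])
      (simp add: trig_poly.lincomb distrib_right mult.assoc)
qed

lemma real_polynomial_function_trig_poly:
  assumes "real_polynomial_function p"
  shows "\<exists>q. trig_poly q \<and> (\<forall>z\<in>sphere 0 1. q z = of_real (p z))"
  using assms
proof induction
  case (linear p)
  interpret bounded_linear p by fact
  \<comment> \<open>A real-linear \<open>p\<close> is \<open>Re z * p 1 + Im z * p \<i>\<close>; on
    the circle the conjugate is the inverse, so Re z = (z + 1/z)/2 and Im z = (z -
    1/z)/(2i).\<close>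
  define q where "q z = (of_real (p 1) / 2 + of_real (p \<i>) / (2 * \<i>)) * z powi 1
      + (of_real (p 1) / 2 - of_real (p \<i>) / (2 * \<i>)) * z powi (- 1)" for z
  have "q z = of_real (p z)" if "z \<in> sphere 0 1" for z
  proof -
    have z: "z * cnj z = 1" using that complex_norm_square[of z] by simp
    then have inv: "inverse z = cnj z" by (rule inverse_unique)
    have "p z = p (Re z *\<^sub>R 1 + Im z *\<^sub>R \<i>)"
      by (rule arg_cong[of _ _ p]) (simp add: complex_eq_iff)
    then have pz: "p z = Re z * p 1 + Im z * p \<i>"
      by (simp add: add scaleR)
    have "q z = of_real (p 1) * ((z + cnj z) / 2) + of_real (p \<i>) * ((z - cnj z) / (2 * \<i>))"
      unfolding q_def power_int_minus power_int_1_right inv by (simp add: field_simps)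
    also have "(z + cnj z) / 2 = of_real (Re z)"
      by (simp add: complex_add_cnj)
    also have "(z - cnj z) / (2 * \<i>) = of_real (Im z)"
      by (simp add: complex_eq_iff)
    finally show ?thesis unfolding pz by (simp add: mult.commute)
  qed
  moreover have "trig_poly q"
    unfolding q_def by (intro trig_poly.lincomb trig_poly.powi)
  ultimately show ?case by blast
next
  case (const c)
  show ?case
    by (intro exI[of _ "\<lambda>z. of_real c * z powi 0"]) (simp add: trig_poly_cmult trig_poly.powi del: power_int_0_right, simp)
next
  case (add p p')
  then obtain q q' where "trig_poly q" "\<forall>z\<in>sphere 0 1. q z = of_real (p z)"
    "trig_poly q'" "\<forall>z\<in>sphere 0 1. q' z = of_real (p' z)" by blast
  then show ?case
    using trig_poly.lincomb[of q q' 1 1] by (intro exI[of _ "\<lambda>z. q z + q' z"]) simp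
next
  case (mult p p')
  then obtain q q' where q: "trig_poly q" "\<forall>z\<in>sphere 0 1. q z = of_real (p z)"
    "trig_poly q'" "\<forall>z\<in>sphere 0 1. q' z = of_real (p' z)" by blast
  then show ?case using trig_poly_mult[OF q(1,3)] by auto
qed

text \<open>Stone--Weierstrass, followed by the bounded limits that lead from continuous functions to
  closed sets.\<close>

lemma circle_closed_indicator:
  assumes powi: "\<And>k. P (\<lambda>z. z powi k)"
    and lincomb: "\<And>f g a b. P f \<Longrightarrow> P g \<Longrightarrow> P (\<lambda>z. a * f z + b * g z)"
    and lim: "\<And>s f B. (\<And>n::nat. P (s n)) \<Longrightarrow>
      (\<And>n z. z \<in> sphere 0 1 \<Longrightarrow> cmod (s n z) \<le> B) \<Longrightarrow>
      (\<And>z. z \<in> sphere 0 1 \<Longrightarrow> (\<lambda>n. s n z) \<longlonglongrightarrow> f z) \<Longrightarrow> P f"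
    and F: "closed F"
  shows "P (indicator F)"
proof -
  have trig: "P q" if "trig_poly q" for q
    using that by induction (auto intro: powi lincomb)
  have cont: "P (\<lambda>z. of_real (u z))"
    if u: "continuous_on (sphere 0 1) u" "\<And>z. 0 \<le> u z" "\<And>z. u z \<le> 1" for u :: "complex \<Rightarrow> real"
  proof -
    have "\<exists>q. trig_poly q \<and> (\<forall>z\<in>sphere 0 1. cmod (of_real (u z) - q z) < inverse (real (Suc n)))" for n
    proof -
      obtain p where p: "real_polynomial_function p" "\<And>z. z \<in> sphere 0 1 \<Longrightarrow> \<bar>u z - p z\<bar> < inverse (real (Suc n))"
        using Stone_Weierstrass_real_polynomial_function[OF compact_sphere u(1)]
        by (metis inverse_positive_iff_positive of_nat_0_less_iff zero_less_Suc)
      obtain q where q: "trig_poly q" "\<forall>z\<in>sphere 0 1. q z = of_real (p z)"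
        using real_polynomial_function_trig_poly[OF p(1)] by blast
      show ?thesis
        using p(2) q by (metis norm_of_real of_real_diff)
    qed
    then obtain q where q: "\<And>n. trig_poly (q n)"
      and close: "\<And>n z. z \<in> sphere 0 1 \<Longrightarrow> cmod (of_real (u z) - q n z) < inverse (real (Suc n))"
      by metis
    show ?thesis
    proof (rule lim[of q 2])
      show "P (q n)" for n by (rule trig[OF q])
      fix z :: complex assume z: "z \<in> sphere 0 1"
      have "(\<lambda>n. of_real (u z) - q n z) \<longlonglongrightarrow> 0"
        by (rule Lim_null_comparison[OF _ LIMSEQ_inverse_real_of_nat])
          (intro always_eventually allI less_imp_le close z)
      then show "(\<lambda>n. q n z) \<longlonglongrightarrow> of_real (u z)"
        using tendsto_diff[OF tendsto_const[of "of_real (u z)"]] by fastforce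
      fix n
      have "cmod (q n z) \<le> cmod (of_real (u z)) + cmod (of_real (u z) - q n z)"
        using norm_triangle_sub[of "q n z" "of_real (u z)"] by (simp add: norm_minus_commute)
      moreover have "inverse (real (Suc n)) \<le> 1" by (simp add: inverse_le_1_iff)
      ultimately show "cmod (q n z) \<le> 2"
        using close[OF z, of n] u(2,3)[of z] by simp
    qed
  qed
  show ?thesis
  \<comment> \<open>The distance to the empty set is 0 by convention, so the functions
    \<open>u n\<close> below would then tend to 1 instead of 0.\<close>
  proof (cases "F = {}")
    case True
    then have "indicator F = (\<lambda>z. 0 * z powi 0 + 0 * z powi 0 :: complex)" by (simp add: fun_eq_iff)
    then show ?thesis using lincomb[OF powi powi] by metis
  next
    case False
    \<comment> \<open>Tents equal to 1 on \<open>F\<close> that narrow with \<open>n\<close>; off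
      the closed set \<open>F\<close> the distance is positive, so they are eventually 0.\<close>
    define u where "u n z = max 0 (1 - real n * infdist z F)" for n z
    show ?thesis
    proof (rule lim[of "\<lambda>n z. of_real (u n z)" 1])
      show "P (\<lambda>z. of_real (u n z))" for n
        unfolding u_def
        by (rule cont) (auto intro!: continuous_intros simp: infdist_nonneg)
      show "cmod (of_real (u n z)) \<le> 1" for n z
        by (simp add: u_def infdist_nonneg)
      show "(\<lambda>n. of_real (u n z)) \<longlonglongrightarrow> indicator F z" for z
      proof (cases "z \<in> F")
        case True
        then show ?thesis by (simp add: u_def)
      next
        case z: False
        then have pos: "infdist z F > 0"
          using F False in_closed_iff_infdist_zero infdist_nonneg by (metis less_eq_real_def)
        obtain N :: nat where N: "1 / infdist z F < real N" using reals_Archimedean2 by blast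
        have "u n z = 0" if "n \<ge> N" for n
        proof -
          have "1 / infdist z F \<le> real n" using N that by linarith
          then have "1 \<le> real n * infdist z F" using pos by (simp add: divide_le_eq)
          then show ?thesis by (simp add: u_def)
        qed
        then have "\<forall>\<^sub>F n in sequentially. of_real (u n z) = (0::complex)"
          unfolding eventually_sequentially by auto
        then show ?thesis using z by (simp add: tendsto_eventually)
      qed
    qed
  qed
qed

section \<open>Completeness of the characters and uniqueness of Fourier coefficients\<close>

interpretation circle: prob_space circle_haar
  by (rule prob_space_circle_haar)

lemma sets_circle_haar_closed_space:
  "{F. closed F \<and> F \<subseteq> sphere 0 1} \<subseteq> Pow (space circle_haar)"
  "sets circle_haar = sigma_sets (space circle_haar) {F. closed F \<and> F \<subseteq> sphere 0 1}"
  by (auto simp: space_circle_haar sets_circle_haar_closed)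

lemma Int_stable_closed_sphere: "Int_stable {F. closed F \<and> F \<subseteq> sphere (0::complex) 1}"
  by (auto simp: Int_stable_def intro: closed_Int)

lemma L2_circle_bounded:
  assumes "f \<in> borel_measurable circle_haar" "\<And>z. z \<in> sphere 0 1 \<Longrightarrow> cmod (f z) \<le> B"
  shows "f \<in> L2 circle_haar"
  by (rule L2_dominated[OF assms(1), of "\<lambda>_. B\<^sup>2"])
    (auto intro!: AE_I2 power_mono assms(2) simp: space_circle_haar)

lemma L2_circle_powi: "(\<lambda>z. z powi k) \<in> L2 circle_haar"
  by (rule L2_circle_bounded[of _ 1])
    (auto intro!: borel_measurable_circle continuous_on_circle_powi simp: norm_power_int)

text \<open>Closed sets are reached from the characters by \<open>circle_closed_indicator\<close>,
  with membership in \<open>D\<close> as the property; the constant bound is integrable because the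
  total mass is finite.\<close>

lemma L2_circle_dense:
  assumes D: "L2_closed_subspace circle_haar D" and powi: "\<And>k. (\<lambda>z. z powi k) \<in> D"
  shows "D = L2 circle_haar"
proof (rule L2_closed_subspace_eq_L2[OF D Int_stable_closed_sphere sets_circle_haar_closed_space,
    of "\<lambda>_. sphere 0 1"])
  show "indicator F \<in> D" if "F \<in> {F. closed F \<and> F \<subseteq> sphere 0 1}" for F
  proof (rule circle_closed_indicator)
    fix s :: "nat \<Rightarrow> complex \<Rightarrow> complex" and f B
    assume s: "\<And>n. s n \<in> D" and le: "\<And>n z. z \<in> sphere 0 1 \<Longrightarrow> cmod (s n z) \<le> B"
      and lim: "\<And>z. z \<in> sphere 0 1 \<Longrightarrow> (\<lambda>n. s n z) \<longlonglongrightarrow> f z"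
    show "f \<in> D"
    proof (rule L2_closed_subspace_dominated[OF D _ s])
      show "f \<in> borel_measurable circle_haar"
        by (rule borel_measurable_LIMSEQ_metric[of s])
          (use s L2_closed_subspace_subset[OF D] L2_measurable lim in \<open>auto simp: space_circle_haar\<close>)
      show "AE x in circle_haar. (\<lambda>n. s n x) \<longlonglongrightarrow> f x"
        by (rule AE_I2) (simp add: lim space_circle_haar)
      show "AE x in circle_haar. (cmod (s n x))\<^sup>2 \<le> B\<^sup>2" for n
        by (rule AE_I2) (intro power_mono le, simp_all add: space_circle_haar)
    qed simp
  qed (use that powi L2_closed_subspace_lincomb[OF D] in auto)
qed (auto simp: space_circle_haar incseq_def)

text \<open>A finite measure on the circle is determined by its Fourier coefficients: equality of
  integrals spreads from characters to indicators of closed sets, which form an intersection-stable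
  generator.\<close>

lemma circle_measure_eqI:
  assumes M: "finite_measure M" "sets M = sets circle_haar"
    and N: "finite_measure N" "sets N = sets circle_haar"
    and eq: "\<And>k. (LINT z|M. z powi k) = (LINT z|N. z powi k)"
  shows "M = N"
proof (rule measure_eqI_generator_eq[OF Int_stable_closed_sphere])
  interpret M: finite_measure M by (rule M)
  interpret N: finite_measure N by (rule N)
  have space: "space M = sphere 0 1" "space N = sphere 0 1"
    using M(2) N(2) sets_eq_imp_space_eq space_circle_haar by blast+
  show "{F. closed F \<and> F \<subseteq> sphere 0 1} \<subseteq> Pow (sphere (0::complex) 1)" by auto
  show "sets M = sigma_sets (sphere 0 1) {F. closed F \<and> F \<subseteq> sphere 0 1}"
    "sets N = sigma_sets (sphere 0 1) {F. closed F \<and> F \<subseteq> sphere 0 1}"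
    using M N by (simp_all add: sets_circle_haar_closed)
  show "range (\<lambda>_::nat. sphere (0::complex) 1) \<subseteq> {F. closed F \<and> F \<subseteq> sphere 0 1}" by auto
  show "emeasure M F = emeasure N F" if F: "F \<in> {F. closed F \<and> F \<subseteq> sphere 0 1}" for F
  proof -
    \<comment> \<open>Integrability is part of the property so that it survives linear combinations;
      for bounded limits it comes from dominated convergence.\<close>
    define P where "P f \<longleftrightarrow> integrable M f \<and> integrable N f \<and> integral\<^sup>L M f = integral\<^sup>L N f"
      for f :: "complex \<Rightarrow> complex"
    have "P (indicator F)"
    proof (rule circle_closed_indicator)
      show "P (\<lambda>z. z powi k)" for k
        unfolding P_def using eq M(2) N(2)
        by (auto intro!: M.integrable_const_bound[of _ 1] N.integrable_const_bound[of _ 1] AE_I2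
            borel_measurable_circle continuous_on_circle_powi simp: space norm_power_int)
      show "P (\<lambda>z. a * f z + b * g z)" if "P f" "P g" for f g a b
        using that by (simp add: P_def)
      fix s :: "nat \<Rightarrow> complex \<Rightarrow> complex" and f B
      assume s: "\<And>n. P (s n)" and le: "\<And>n z. z \<in> sphere 0 1 \<Longrightarrow> cmod (s n z) \<le> B"
        and lim: "\<And>z. z \<in> sphere 0 1 \<Longrightarrow> (\<lambda>n. s n z) \<longlonglongrightarrow> f z"
      have "s n \<in> borel_measurable M" "s n \<in> borel_measurable N" for n
        using s[of n] by (auto simp: P_def)
      note meas = this
      have f: "f \<in> borel_measurable M" "f \<in> borel_measurable N"
        by (rule borel_measurable_LIMSEQ_metric[of s]; use meas lim in \<open>simp add: space\<close>)+
      have "(\<lambda>n. integral\<^sup>L M (s n)) \<longlonglongrightarrow> integral\<^sup>L M f"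
        by (rule integral_dominated_convergence[of _ _ _ "\<lambda>_. B"])
          (use f meas lim le in \<open>auto intro!: AE_I2 simp: space\<close>)
      moreover have "(\<lambda>n. integral\<^sup>L N (s n)) \<longlonglongrightarrow> integral\<^sup>L N f"
        by (rule integral_dominated_convergence[of _ _ _ "\<lambda>_. B"])
          (use f meas lim le in \<open>auto intro!: AE_I2 simp: space\<close>)
      moreover have "integral\<^sup>L M (s n) = integral\<^sup>L N (s n)" for n
        using s[of n] by (simp add: P_def)
      ultimately have "integral\<^sup>L M f = integral\<^sup>L N f"
        using LIMSEQ_unique by auto
      moreover have "integrable M f"
        by (rule integrable_dominated_convergence[of _ _ s "\<lambda>_. B"])
          (use f meas lim le in \<open>auto intro!: AE_I2 simp: space\<close>)
      moreover have "integrable N f"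
        by (rule integrable_dominated_convergence[of _ _ s "\<lambda>_. B"])
          (use f meas lim le in \<open>auto intro!: AE_I2 simp: space\<close>)
      ultimately show "P f" by (simp add: P_def)
    qed (use F in auto)
    moreover have "F \<inter> space M = F" "F \<inter> space N = F" using F space by auto
    moreover have "(indicator F :: complex \<Rightarrow> complex) = (\<lambda>z. of_real (indicator F z))"
      by (auto simp: fun_eq_iff indicator_def)
    ultimately have "measure M F = measure N F"
      unfolding P_def by simp
    then show ?thesis by (simp add: M.emeasure_eq_measure N.emeasure_eq_measure)
  qed
qed (use finite_measure.emeasure_finite[OF M(1)] in auto)

lemma circle_haar_integral_powi: "(LINT z|circle_haar. z powi k) = (if k = 0 then 1 else 0)"
proof -
  let ?U = "uniform_measure lborel {0..<2*pi}"
  have "(\<lambda>t. cis (- t)) \<in> borel_measurable borel"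
    by (intro borel_measurable_continuous_onI continuous_intros)
  then have "(\<lambda>t. cis (- t)) \<in> lborel \<rightarrow>\<^sub>M restrict_space borel (sphere 0 1)"
    by (intro measurable_restrict_space2) auto
  then have meas: "(\<lambda>t. cis (- t)) \<in> ?U \<rightarrow>\<^sub>M restrict_space borel (sphere 0 1)"
    by (simp cong: measurable_cong_sets)
  have "(\<lambda>z::complex. z powi k) \<in> borel_measurable (restrict_space borel (sphere 0 1))"
    by (intro borel_measurable_continuous_on_restrict continuous_on_circle_powi)
  then have "(LINT z|circle_haar. z powi k) = (LINT t|?U. cis (- t) powi k)"
    unfolding circle_haar_def by (intro integral_distr meas)
  also have "?U = density lborel (\<lambda>t. ennreal (indicator {0..<2*pi} t / (2 * pi)))"
    unfolding uniform_measure_def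
    by (intro arg_cong[of _ _ "density lborel"]) (auto simp: indicator_def divide_ennreal[symmetric] ennreal_1[symmetric] simp del: ennreal_1)
  also have "(LINT t|\<dots>. cis (- t) powi k)
      = (LINT t|lborel. (indicator {0..<2*pi} t / (2 * pi)) *\<^sub>R cis (- t) powi k)"
    by (intro integral_density) (auto intro!: borel_measurable_continuous_onI continuous_intros)
  \<comment> \<open>Adding the null point \<open>2*pi\<close> gives the closed interval on which the
    fundamental theorem of calculus is applied.\<close>
  also have "\<dots> = (LINT t|lborel. (1 / (2 * pi)) *\<^sub>R (indicator {0..2*pi} t *\<^sub>R cis (of_int k * - t)))"
  proof (rule integral_cong_AE)
    show "AE t in lborel. (indicator {0..<2*pi} t / (2 * pi)) *\<^sub>R cis (- t) powi k
        = (1 / (2 * pi)) *\<^sub>R (indicator {0..2*pi} t *\<^sub>R cis (of_int k * - t))"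
      using AE_lborel_singleton[of "2*pi"] by eventually_elim (auto simp: indicator_def cis_power_int)
    have [measurable]: "(\<lambda>t. cis (of_int k * - t)) \<in> borel_measurable lborel"
      by (auto intro!: borel_measurable_continuous_onI continuous_intros)
    show "(\<lambda>t. (indicator {0..<2*pi} t / (2 * pi)) *\<^sub>R cis (- t) powi k) \<in> borel_measurable lborel"
      "(\<lambda>t. (1 / (2 * pi)) *\<^sub>R (indicator {0..2*pi} t *\<^sub>R cis (of_int k * - t)))
        \<in> borel_measurable lborel"
      unfolding cis_power_int by measurable
  qed
  also have "\<dots> = (1 / (2 * pi)) *\<^sub>R (LINT t|lborel. indicator {0..2*pi} t *\<^sub>R cis (of_int k * - t))"
    by (rule integral_scaleR_right)
  also have "\<dots> = (if k = 0 then 1 else 0)"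
  proof (cases "k = 0")
    case True
    then show ?thesis by simp
  next
    case False
    \<comment> \<open>An antiderivative of the integrand; it has period \<open>2*pi\<close>, so its
      increment over the interval is 0.\<close>
    define G where "G t = \<i> / of_int k * cis (of_int k * - t)" for t
    have "(LINT t|lborel. indicator {0..2*pi} t *\<^sub>R cis (of_int k * - t)) = G (2*pi) - G 0"
    proof (rule integral_FTC_Icc)
      fix t
      have "((\<lambda>t. cis (of_int k * - t)) has_vector_derivative
          (of_int k * -1) *\<^sub>R (\<i> * cis (of_int k * - t))) (at t within {0..2*pi})"
        unfolding cis_conv_exp
        by (auto intro!: derivative_eq_intros has_vector_derivative_real_field simp: scaleR_conv_of_real)
      from has_vector_derivative_mult_right[OF this, of "\<i> / of_int k"]
      show "(G has_vector_derivative cis (of_int k * - t)) (at t within {0..2*pi})"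
        using False by (simp add: G_def[abs_def] scaleR_conv_of_real field_simps)
    qed (auto intro!: continuous_intros)
    also have "\<dots> = 0"
      using cis_multiple_2pi[of "of_int (-k)"] by (simp add: G_def algebra_simps)
    finally show ?thesis using False by simp
  qed
  finally show ?thesis .
qed

text \<open>With \<open>f = 1\<close> this gives orthonormality of the characters, with the filter
  as \<open>f\<close> the Fourier coefficients of its squared modulus.\<close>

lemma L2_inner_circle_powi:
  assumes "f \<in> borel_measurable circle_haar"
  shows "L2_inner circle_haar (\<lambda>z. z powi k * f z) (\<lambda>z. z powi l * f z)
    = (LINT z|circle_haar. (cmod (f z))\<^sup>2 *\<^sub>R z powi (k - l))"
  unfolding L2_inner_def
proof (rule Bochner_Integration.integral_cong)
  fix z assume "z \<in> space circle_haar"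
  then have z: "cmod z = 1" by (simp add: space_circle_haar)
  then have "z \<noteq> 0" by auto
  have "z * cnj z = 1" using z complex_norm_square[of z] by simp
  then have "cnj z = inverse z" by (rule inverse_unique[symmetric])
  then have "cnj (z powi l) = z powi (- l)"
    by (simp add: power_int_minus power_int_inverse)
  then have "z powi k * f z * cnj (z powi l * f z) = (z powi k * z powi (- l)) * (f z * cnj (f z))"
    by simp
  also have "\<dots> = (cmod (f z))\<^sup>2 *\<^sub>R z powi (k - l)"
    using \<open>z \<noteq> 0\<close> by (simp only: power_int_add[symmetric] diff_conv_add_uminus
        complex_norm_square[symmetric] scaleR_conv_of_real mult.commute simp_thms)
  finally show "z powi k * f z * cnj (z powi l * f z) = (cmod (f z))\<^sup>2 *\<^sub>R z powi (k - l)" .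
qed simp

lemma circle_powi_mult_L2:
  assumes "f \<in> L2 circle_haar"
  shows "(\<lambda>z. z powi k * f z) \<in> L2 circle_haar"
    and "L2_norm circle_haar (\<lambda>z. z powi k * f z) = L2_norm circle_haar f"
proof -
  have meas: "(\<lambda>z. z powi k * f z) \<in> borel_measurable circle_haar"
    by (intro borel_measurable_times L2_measurable L2_circle_powi assms)
  have eq: "(cmod (z powi k * f z))\<^sup>2 = (cmod (f z))\<^sup>2" if "z \<in> space circle_haar" for z
    using that by (simp add: space_circle_haar norm_mult norm_power_int)
  show "(\<lambda>z. z powi k * f z) \<in> L2 circle_haar"
    by (rule L2_dominated[OF meas L2_integrable[OF assms]]) (simp add: eq)
  show "L2_norm circle_haar (\<lambda>z. z powi k * f z) = L2_norm circle_haar f"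
    unfolding L2_norm_def using eq by (simp cong: Bochner_Integration.integral_cong)
qed

section \<open>Translation and dilation on the line\<close>

lemma translate_lincomb:
  "translate s (\<lambda>x. a * f x + b * g x) = (\<lambda>x. a * translate s f x + b * translate s g x)"
  by (simp add: translate_def fun_eq_iff)

lemma translate_translate: "translate s (translate t f) = translate (s + t) f"
  by (simp add: translate_def fun_eq_iff algebra_simps)

lemma translate_L2:
  assumes "f \<in> L2 lborel" shows "translate s f \<in> L2 lborel"
proof -
  have "f \<in> borel_measurable borel" using L2_measurable[OF assms] by simp
  then have "translate s f \<in> borel_measurable lborel"
    unfolding translate_def[abs_def] by measurable
  then show ?thesis
    using lborel_integrable_real_affine[OF L2_integrable[OF assms], of 1 "- s"]
    by (simp add: L2_def translate_def)
qed

lemma L2_inner_translate: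
  "L2_inner lborel (translate s f) (translate s g) = L2_inner lborel f g"
  unfolding L2_inner_def translate_def
  using lborel_integral_real_affine[of 1 "\<lambda>x. f x * cnj (g x)" "- s"] by simp

lemma L2_norm_translate: "L2_norm lborel (translate s f) = L2_norm lborel f"
  unfolding L2_norm_def translate_def
  using lborel_integral_real_affine[of 1 "\<lambda>x. (cmod (f x))\<^sup>2" "- s"] by simp

lemma translate_0: "translate 0 f = f"
  by (simp add: translate_def fun_eq_iff)

lemma L2_inner_translate_left:
  "L2_inner lborel (translate s f) g = L2_inner lborel f (translate (- s) g)"
  using L2_inner_translate[of s f "translate (- s) g"]
  by (simp add: translate_translate translate_0)

lemma dilation_lincomb:
  "dilation (\<lambda>x. a * f x + b * g x) = (\<lambda>x. a * dilation f x + b * dilation g x)"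
  by (simp add: dilation_def fun_eq_iff distrib_left mult.left_commute)

text \<open>This commutation relation accounts both for the square in the filter operator and for
  the halving of translations.\<close>

lemma dilation_translate: "dilation (translate s f) = translate (2 * s) (dilation f)"
  by (simp add: dilation_def translate_def fun_eq_iff diff_divide_distrib)

lemma two_powr_half_square: "(2 powr (-1/2) :: real) * 2 powr (-1/2) = 1/2"
proof -
  have "(2 powr (-1/2) :: real) * 2 powr (-1/2) = 2 powr (- 1)"
    by (simp add: powr_add[symmetric])
  also have "\<dots> = 1/2"
    using powr_neg_one[of "2::real"] by simp
  finally show ?thesis .
qed

lemma dilation_mult_cnj:
  "dilation f x * cnj (dilation g x) = (1/2) *\<^sub>R (f (x / 2) * cnj (g (x / 2)))"
proof -
  have "dilation f x * cnj (dilation g x)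
      = of_real (2 powr (-1/2) * 2 powr (-1/2)) * (f (x / 2) * cnj (g (x / 2)))"
    by (simp add: dilation_def)
  then show ?thesis
    unfolding two_powr_half_square scaleR_conv_of_real .
qed

lemma dilation_norm_sq: "(cmod (dilation f x))\<^sup>2 = (1/2) * (cmod (f (x / 2)))\<^sup>2"
proof -
  have "complex_of_real ((cmod (dilation f x))\<^sup>2) = of_real ((1/2) * (cmod (f (x / 2)))\<^sup>2)"
    unfolding of_real_mult complex_norm_square dilation_mult_cnj
    by (simp add: scaleR_conv_of_real)
  then show ?thesis by (simp only: of_real_eq_iff)
qed

lemma dilation_L2:
  assumes "f \<in> L2 lborel" shows "dilation f \<in> L2 lborel"
proof -
  have "f \<in> borel_measurable borel" using L2_measurable[OF assms] by simp
  then have "dilation f \<in> borel_measurable lborel"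
    unfolding dilation_def[abs_def] by measurable
  then show ?thesis
    using lborel_integrable_real_affine[OF L2_integrable[OF assms], of "1/2" 0]
    by (simp add: L2_def dilation_norm_sq)
qed

lemma L2_inner_dilation: "L2_inner lborel (dilation f) (dilation g) = L2_inner lborel f g"
  unfolding L2_inner_def dilation_mult_cnj integral_scaleR_right
  using lborel_integral_real_affine[of "1/2" "\<lambda>x. f x * cnj (g x)" 0] by simp

lemma L2_norm_dilation: "L2_norm lborel (dilation f) = L2_norm lborel f"
  unfolding L2_norm_def dilation_norm_sq
  using lborel_integral_real_affine[of "1/2" "\<lambda>x. (cmod (f x))\<^sup>2" 0] by simp

lemma inv_dilation_L2:
  assumes "f \<in> L2 lborel" shows "inv dilation f \<in> L2 lborel"
proof -
  have "dilation (\<lambda>x. of_real (2 powr (1/2)) * f (2 * x)) = f"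
    by (simp add: dilation_def fun_eq_iff mult.assoc[symmetric] powr_add[symmetric] flip: of_real_mult)
  then have "inv dilation f = (\<lambda>x. of_real (2 powr (1/2)) * f (2 * x))"
    using bij_dilation by (metis bij_inv_eq_iff)
  moreover have "(\<lambda>x. f (2 * x)) \<in> L2 lborel"
  proof -
    have [measurable]: "f \<in> borel_measurable borel" using L2_measurable[OF assms] by simp
    have "(\<lambda>x. f (2 * x)) \<in> borel_measurable lborel" by measurable
    then show ?thesis
      using lborel_integrable_real_affine[OF L2_integrable[OF assms], of 2 0]
      by (simp add: L2_def)
  qed
  ultimately show ?thesis by (simp add: L2_cmult)
qed

section \<open>Strong continuity of translations\<close>

lemma Ioc_generator:
  "Int_stable (range (\<lambda>(a, b). {a<..b::real}))"
  "range (\<lambda>(a, b). {a<..b::real}) \<subseteq> Pow (space lborel)"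
  "sets lborel = sigma_sets (space lborel) (range (\<lambda>(a, b). {a<..b::real}))"
proof -
  show "Int_stable (range (\<lambda>(a, b). {a<..b::real}))"
    unfolding Int_stable_def
  proof safe
    fix a b c d :: real
    have "{a<..b} \<inter> {c<..d} = {max a c<..min b d}" by auto
    then show "{a<..b} \<inter> {c<..d} \<in> range (\<lambda>(a, b). {a<..b})" by auto
  qed
  show "sets lborel = sigma_sets (space lborel) (range (\<lambda>(a, b). {a<..b::real}))"
    using arg_cong[OF borel_sigma_sets_Ioc, of sets] by simp
qed simp

text \<open>Translations are isometries, so the functions for which convergence holds form a closed
  subspace; it remains to find the indicators of bounded intervals in it.\<close>

lemma tendsto_translate:
  assumes f: "f \<in> L2 lborel" and s: "s \<longlonglongrightarrow> 0"
  shows "(\<lambda>n. L2_norm lborel (\<lambda>x. f x - translate (s n) f x)) \<longlonglongrightarrow> 0"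
proof -
  define D where "D = {f \<in> L2 lborel. (\<lambda>n. L2_norm lborel (\<lambda>x. f x - translate (s n) f x)) \<longlonglongrightarrow> 0}"
  have closed: "L2_closed_subspace lborel D"
    unfolding L2_closed_subspace_def
  proof (intro conjI ballI allI subsetI)
    show "D \<noteq> {}"
      using L2_0[of lborel] by (auto simp: D_def translate_def L2_norm_def)
  next
    fix f g a b assume fg: "f \<in> D" "g \<in> D"
    let ?R = "\<lambda>n. cmod a * L2_norm lborel (\<lambda>x. f x - translate (s n) f x)
        + cmod b * L2_norm lborel (\<lambda>x. g x - translate (s n) g x)"
    have "?R \<longlonglongrightarrow> cmod a * 0 + cmod b * 0"
      using fg unfolding D_def by (intro tendsto_add tendsto_mult tendsto_const) auto
    then have "?R \<longlonglongrightarrow> 0" by simp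
    then have "(\<lambda>n. L2_norm lborel (\<lambda>x. (a * f x + b * g x) - translate (s n) (\<lambda>x. a * f x + b * g x) x)) \<longlonglongrightarrow> 0"
    proof (rule Lim_null_comparison[rotated], intro always_eventually allI)
      fix n
      show "norm (L2_norm lborel (\<lambda>x. (a * f x + b * g x) - translate (s n) (\<lambda>x. a * f x + b * g x) x)) \<le> ?R n"
        using fg L2_norm_lincomb_diff_le[of f lborel "translate (s n) f" g "translate (s n) g" a b]
        by (simp add: D_def translate_L2 translate_lincomb L2_norm_nonneg)
    qed
    then show "(\<lambda>x. a * f x + b * g x) \<in> D"
      using fg by (simp add: D_def L2_lincomb)
  next
    fix f assume f: "f \<in> L2_closure lborel D"
    then have f_L2: "f \<in> L2 lborel" by (simp add: L2_closure_def)
    have "\<forall>\<^sub>F n in sequentially. L2_norm lborel (\<lambda>x. f x - translate (s n) f x) < e" if "e > 0" for e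
    proof -
      have "e / 3 > 0" using that by simp
      then obtain g where g: "g \<in> D" "L2_norm lborel (\<lambda>x. f x - g x) < e / 3"
        using f unfolding L2_closure_def by blast
      have g_L2: "g \<in> L2 lborel" using g by (simp add: D_def)
      have "(\<lambda>n. L2_norm lborel (\<lambda>x. g x - translate (s n) g x)) \<longlonglongrightarrow> 0"
        using g(1) by (simp add: D_def)
      then have "\<forall>\<^sub>F n in sequentially. L2_norm lborel (\<lambda>x. g x - translate (s n) g x) < e / 3"
        using \<open>e / 3 > 0\<close> by (rule order_tendstoD)
      then show ?thesis
      proof eventually_elim
        case (elim n)
        have "L2_norm lborel (\<lambda>x. translate (s n) g x - translate (s n) f x) = L2_norm lborel (\<lambda>x. g x - f x)"
          using L2_norm_translate[of "s n" "\<lambda>x. g x - f x"] by (simp add: translate_def[abs_def])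
        then have 1: "L2_norm lborel (\<lambda>x. translate (s n) g x - translate (s n) f x) < e / 3"
          using g(2) L2_norm_minus_commute[of lborel g f] by simp
        have "L2_norm lborel (\<lambda>x. f x - translate (s n) f x)
            \<le> L2_norm lborel (\<lambda>x. f x - g x) + L2_norm lborel (\<lambda>x. g x - translate (s n) f x)"
          by (intro L2_dist_triangle f_L2 g_L2 translate_L2)
        also have "L2_norm lborel (\<lambda>x. g x - translate (s n) f x)
            \<le> L2_norm lborel (\<lambda>x. g x - translate (s n) g x)
              + L2_norm lborel (\<lambda>x. translate (s n) g x - translate (s n) f x)"
          by (intro L2_dist_triangle f_L2 g_L2 translate_L2)
        finally show ?case using g(2) elim 1 by linarith
      qed
    qed
    then have "(\<lambda>n. L2_norm lborel (\<lambda>x. f x - translate (s n) f x)) \<longlonglongrightarrow> 0"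
      by (simp add: tendsto_iff L2_norm_nonneg)
    then show "f \<in> D" using f_L2 by (simp add: D_def)
  qed (simp add: D_def)
  have indicator: "indicator {a<..b} \<in> D" for a b :: real
  proof -
    let ?I = "indicator {a<..b} :: real \<Rightarrow> complex"
    have I_L2: "?I \<in> L2 lborel"
    proof (rule L2_dominated)
      show "integrable lborel (indicator {a..b} :: real \<Rightarrow> real)"
        by (intro integrable_real_indicator) (auto simp: emeasure_lborel_Icc_eq)
      show "AE x in lborel. (cmod (?I x))\<^sup>2 \<le> indicator {a..b} x"
        by (auto simp: indicator_def)
    qed simp
    have [measurable]: "?I \<in> borel_measurable lborel" "translate (s n) ?I \<in> borel_measurable lborel" for n
      using I_L2 translate_L2 L2_measurable by blast+
    obtain B where B: "\<And>n. norm (s n) \<le> B"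
      using convergent_imp_Bseq[of s] s by (auto simp: convergent_def Bseq_def)
    have "(\<lambda>n. LINT x|lborel. (cmod (?I x - translate (s n) ?I x))\<^sup>2) \<longlonglongrightarrow> integral\<^sup>L lborel (\<lambda>x::real. 0::real)"
    proof (rule integral_dominated_convergence)
      \<comment> \<open>\<open>B\<close> bounds the convergent sequence \<open>s\<close>, so the
        interval and all its translates lie in this one.\<close>
      show "integrable lborel (indicator {a - B..b + B} :: real \<Rightarrow> real)"
        by (intro integrable_real_indicator) (auto simp: emeasure_lborel_Icc_eq)
      show "AE x in lborel. norm ((cmod (?I x - translate (s n) ?I x))\<^sup>2) \<le> indicator {a - B..b + B} x" for n
        using B[of n] by (auto simp: indicator_def translate_def)
      show "AE x in lborel. (\<lambda>n. (cmod (?I x - translate (s n) ?I x))\<^sup>2) \<longlonglongrightarrow> 0"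
        using AE_lborel_singleton[of a] AE_lborel_singleton[of b]
      proof eventually_elim
        case (elim x)
        \<comment> \<open>A translation shorter than the distance to both endpoints does not change
          whether \<open>x\<close> is in the interval.\<close>
        define r where "r = min \<bar>x - a\<bar> \<bar>x - b\<bar>"
        have "r > 0" using elim by (simp add: r_def)
        with s have "\<forall>\<^sub>F n in sequentially. dist (s n) 0 < r" by (rule tendstoD)
        then have "\<forall>\<^sub>F n in sequentially. (cmod (?I x - translate (s n) ?I x))\<^sup>2 = 0"
          by eventually_elim (auto simp: r_def indicator_def translate_def)
        then show ?case by (rule tendsto_eventually)
      qed
    qed (use borel_measurable_const in measurable)
    then have "(\<lambda>n. sqrt (LINT x|lborel. (cmod (?I x - translate (s n) ?I x))\<^sup>2)) \<longlonglongrightarrow> sqrt 0"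
      by (intro tendsto_real_sqrt) simp
    then show ?thesis
      using I_L2 by (simp add: D_def L2_norm_def)
  qed
  have "D = L2 lborel"
  proof (rule L2_closed_subspace_eq_L2[OF closed Ioc_generator, of "\<lambda>n. {- real n<..real n}"])
    show "incseq (\<lambda>n. {- real n<..real n})" by (auto simp: incseq_def)
    show "(\<Union>n. {- real n<..real n}) = space lborel"
    proof -
      have "\<exists>n. x \<in> {- real n<..real n}" for x
      proof -
        obtain n :: nat where "\<bar>x\<bar> < real n" using reals_Archimedean2 by blast
        then have "x \<in> {- real n<..real n}" by auto
        then show ?thesis by blast
      qed
      then show ?thesis by auto
    qed
  qed (auto intro: indicator)
  then show ?thesis using f by (auto simp: D_def)
qed

section \<open>The filter operator\<close>

lemma measurable_square_circle: "(\<lambda>z. z\<^sup>2) \<in> circle_haar \<rightarrow>\<^sub>M circle_haar"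
proof -
  have "(\<lambda>z::complex. z\<^sup>2) \<in> restrict_space borel (sphere 0 1) \<rightarrow>\<^sub>M restrict_space borel (sphere 0 1)"
    by (intro measurable_restrict_space3) (auto simp: norm_power)
  then show ?thesis
    by (simp add: measurable_cong_sets[OF sets_circle_haar sets_circle_haar])
qed

text \<open>The Fourier coefficients of the image measure are the even coefficients of |m|^2, so
  \<open>circle_measure_eqI\<close> applies. In terms of densities this is the quadrature filter
  identity |m(z)|^2 + |m(-z)|^2 = 2 almost everywhere.\<close>

lemma distr_square_scaled_circle_haar_eq:
  assumes m: "m \<in> L2 circle_haar"
    and coeff: "\<And>k. (LINT z|circle_haar. (cmod (m z))\<^sup>2 *\<^sub>R z powi (2 * k)) = (if k = 0 then 1 else 0)"
  shows "distr (density circle_haar (\<lambda>z. ennreal ((cmod (m z))\<^sup>2))) circle_haar (\<lambda>z. z\<^sup>2) = circle_haar"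
    (is "distr ?d _ _ = _")
proof -
  have [measurable]: "m \<in> borel_measurable circle_haar" using m by (rule L2_measurable)
  have sq': "(\<lambda>z. z\<^sup>2) \<in> ?d \<rightarrow>\<^sub>M circle_haar"
    using measurable_square_circle by (simp cong: measurable_cong_sets)
  have "emeasure ?d (space ?d) = (\<integral>\<^sup>+z. ennreal ((cmod (m z))\<^sup>2) \<partial>circle_haar)"
    by (subst emeasure_density) (auto intro!: nn_integral_cong simp: indicator_def)
  also have "\<dots> = ennreal (LINT z|circle_haar. (cmod (m z))\<^sup>2)"
    by (rule nn_integral_eq_integral) (auto intro: L2_integrable m)
  finally have "finite_measure ?d" by (intro finite_measureI) simp
  then have fin: "finite_measure (distr ?d circle_haar (\<lambda>z. z\<^sup>2))"
    by (rule finite_measure.finite_measure_distr) (rule sq')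
  show ?thesis
  proof (rule circle_measure_eqI[OF fin])
    fix k
    have powi: "(\<lambda>z. z powi k) \<in> borel_measurable circle_haar" for k :: int
      by (rule L2_measurable[OF L2_circle_powi])
    have "(LINT z|distr ?d circle_haar (\<lambda>z. z\<^sup>2). z powi k) = (LINT z|?d. (z\<^sup>2) powi k)"
      by (rule integral_distr[OF sq' powi])
    also have "\<dots> = (LINT z|?d. z powi (2 * k))"
      by (simp add: power_int_mult)
    also have "\<dots> = (LINT z|circle_haar. (cmod (m z))\<^sup>2 *\<^sub>R z powi (2 * k))"
      by (rule integral_density) (use powi in auto)
    finally show "(LINT z|distr ?d circle_haar (\<lambda>z. z\<^sup>2). z powi k) = (LINT z|circle_haar. z powi k)"
      by (simp only: coeff circle_haar_integral_powi)
  qed (auto intro: circle.finite_measure_axioms)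
qed

text \<open>The integral of |m(z)|^2 |f(z^2)|^2 is the integral of |f|^2 against the image measure,
  which is Haar measure. Thus integrability and the norm come out together, with no bound on
  \<open>m\<close>.\<close>

lemma filter_operator_L2:
  assumes m: "m \<in> L2 circle_haar"
    and coeff: "\<And>k. (LINT z|circle_haar. (cmod (m z))\<^sup>2 *\<^sub>R z powi (2 * k)) = (if k = 0 then 1 else 0)"
    and f: "f \<in> L2 circle_haar"
  shows "filter_operator m f \<in> L2 circle_haar"
    and "L2_norm circle_haar (filter_operator m f) = L2_norm circle_haar f"
proof -
  let ?d = "density circle_haar (\<lambda>z. ennreal ((cmod (m z))\<^sup>2))"
  note distr = distr_square_scaled_circle_haar_eq[OF m coeff]
  have [measurable]: "m \<in> borel_measurable circle_haar" using m by (rule L2_measurable)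
  note [measurable] = measurable_square_circle
  have sq': "(\<lambda>z. z\<^sup>2) \<in> ?d \<rightarrow>\<^sub>M circle_haar"
    using measurable_square_circle by (simp cong: measurable_cong_sets)
  have f_meas[measurable]: "f \<in> borel_measurable circle_haar" using f by (rule L2_measurable)
  have f2: "(\<lambda>z. (cmod (f z))\<^sup>2) \<in> borel_measurable circle_haar" by measurable
  have f2_sq: "(\<lambda>z. (cmod (f (z\<^sup>2)))\<^sup>2) \<in> borel_measurable circle_haar"
    using measurable_compose[OF measurable_square_circle f2] .
  have norm: "(cmod (filter_operator m f z))\<^sup>2 = (cmod (m z))\<^sup>2 *\<^sub>R (cmod (f (z\<^sup>2)))\<^sup>2" for z
    by (simp add: filter_operator_def norm_mult power_mult_distrib)
  have "integrable (distr ?d circle_haar (\<lambda>z. z\<^sup>2)) (\<lambda>z. (cmod (f z))\<^sup>2)"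
    using L2_integrable[OF f] by (simp only: distr)
  then have "integrable ?d (\<lambda>z. (cmod (f (z\<^sup>2)))\<^sup>2)"
    by (simp only: integrable_distr_eq[OF sq' f2])
  then have int: "integrable circle_haar (\<lambda>z. (cmod (filter_operator m f z))\<^sup>2)"
    unfolding norm by (subst (asm) integrable_density) (auto simp: f2_sq)
  have "filter_operator m f \<in> borel_measurable circle_haar"
    unfolding filter_operator_def[abs_def] using measurable_compose[OF measurable_square_circle f_meas] by measurable
  then show "filter_operator m f \<in> L2 circle_haar" using int by (simp add: L2_def)
  have "(LINT z|circle_haar. (cmod (f z))\<^sup>2) = (LINT z|distr ?d circle_haar (\<lambda>z. z\<^sup>2). (cmod (f z))\<^sup>2)"
    by (simp only: distr)
  also have "\<dots> = (LINT z|?d. (cmod (f (z\<^sup>2)))\<^sup>2)"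
    by (rule integral_distr[OF sq' f2])
  also have "\<dots> = (LINT z|circle_haar. (cmod (filter_operator m f z))\<^sup>2)"
    unfolding norm by (rule integral_density) (auto simp: f2_sq)
  finally show "L2_norm circle_haar (filter_operator m f) = L2_norm circle_haar f"
    by (simp add: L2_norm_def)
qed

lemma filter_operator_lincomb:
  "filter_operator m (\<lambda>z. a * f z + b * g z)
    = (\<lambda>z. a * filter_operator m f z + b * filter_operator m g z)"
  by (simp add: filter_operator_def fun_eq_iff algebra_simps)

text \<open>Independence of the representative follows from norm preservation, applied to a
  difference of norm zero.\<close>

lemma filter_operator_isometry:
  assumes m: "m \<in> L2 circle_haar"
    and coeff: "\<And>k. (LINT z|circle_haar. (cmod (m z))\<^sup>2 *\<^sub>R z powi (2 * k)) = (if k = 0 then 1 else 0)"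
  shows "L2_isometry circle_haar (filter_operator m)"
  unfolding L2_isometry_def L2_linear_operator_def
proof (intro conjI ballI impI allI)
  fix f g assume fg: "f \<in> L2 circle_haar" "g \<in> L2 circle_haar" "AE z in circle_haar. f z = g z"
  have "L2_norm circle_haar (\<lambda>z. f z - g z) = 0"
    using fg L2_norm_eq_0_iff[OF L2_diff[OF fg(1,2)]] by simp
  then have "L2_norm circle_haar (filter_operator m (\<lambda>z. f z - g z)) = 0"
    by (simp add: filter_operator_L2(2)[OF m coeff] L2_diff fg)
  then have "AE z in circle_haar. filter_operator m (\<lambda>z. f z - g z) z = 0"
    using L2_norm_eq_0_iff[OF filter_operator_L2(1)[OF m coeff L2_diff[OF fg(1,2)]]] by simp
  then show "AE z in circle_haar. filter_operator m f z = filter_operator m g z"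
    by eventually_elim (simp add: filter_operator_def algebra_simps)
qed (simp_all add: filter_operator_L2[OF m coeff] filter_operator_lincomb)

section \<open>The father function and its filter: intertwining and the shift property\<close>

context
  fixes \<phi> :: "real \<Rightarrow> complex" and a :: "int \<Rightarrow> complex" and m\<^sub>0 :: "complex \<Rightarrow> complex"
  assumes father: "scale2_father \<phi>"
    and \<phi>_sum: "L2_has_sum lborel (\<lambda>k x. a k * translate (of_int k) \<phi> x) (dilation \<phi>) UNIV"
    and m_sum: "L2_has_sum circle_haar (\<lambda>k z. a k * z powi k) m\<^sub>0 UNIV"
begin

abbreviation (input) "corr \<equiv>
  L2_corr circle_haar lborel (\<lambda>k z. z powi k) (\<lambda>k::int. translate (of_int k) \<phi>)"

lemma father_L2: "\<phi> \<in> L2 lborel"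
  using father by (simp add: scale2_father_def)

lemma father_orthonormal:
  "L2_inner lborel (translate (of_int j) \<phi>) (translate (of_int k) \<phi>) = (if j = k then 1 else 0)"
  using father by (simp add: scale2_father_def L2_orthonormal_def)

lemma filter_L2: "m\<^sub>0 \<in> L2 circle_haar"
  using m_sum by (simp add: L2_has_sum_def)

lemma father_gram:
  "L2_inner circle_haar (\<lambda>z. z powi j) (\<lambda>z. z powi k)
    = L2_inner lborel (translate (of_int j) \<phi>) (translate (of_int k) \<phi>)"
  using L2_inner_circle_powi[of "\<lambda>_. 1" j k]
  by (simp add: father_orthonormal circle_haar_integral_powi)

lemmas corr_inner = L2_corr_inner[of "\<lambda>k z. z powi k" circle_haar "\<lambda>k::int. translate (of_int k) \<phi>" lborel,
      OF L2_circle_powi translate_L2[OF father_L2] father_gram]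
  and corr_norm = L2_corr_norm[of "\<lambda>k z. z powi k" circle_haar "\<lambda>k::int. translate (of_int k) \<phi>" lborel,
      OF L2_circle_powi translate_L2[OF father_L2] father_gram]
  and corr_unique = L2_corr_unique[of "\<lambda>k z. z powi k" circle_haar "\<lambda>k::int. translate (of_int k) \<phi>" lborel,
      OF L2_circle_powi translate_L2[OF father_L2] father_gram]

lemma corr_filter: "corr m\<^sub>0 (dilation \<phi>)"
  by (rule L2_corr_has_sum[OF m_sum \<phi>_sum L2_circle_powi translate_L2[OF father_L2]])

lemma corr_generator: "corr (\<lambda>z. z powi k) (translate (of_int k) \<phi>)"
  by (rule L2_corr.generator[OF L2_circle_powi translate_L2[OF father_L2]])

lemma corr_total:
  assumes "f \<in> L2 circle_haar" shows "\<exists>h. corr f h"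
proof -
  have "{f. \<exists>h. corr f h} = L2 circle_haar"
    by (rule L2_circle_dense)
      (use corr_generator in \<open>auto intro: L2_closed_subspace_corr_domain L2_circle_powi
        translate_L2[OF father_L2] father_gram\<close>)
  then show ?thesis using assms by blast
qed

lemma corr_translate:
  assumes "corr f h" shows "corr (\<lambda>z. z powi k * f z) (translate (of_int k) h)"
proof (rule L2_corr_map[OF assms, of "\<lambda>f z. z powi k * f z"])
  fix l
  have "corr (\<lambda>z. z powi (k + l)) (translate (of_int (k + l)) \<phi>)"
    by (rule corr_generator)
  \<comment> \<open>Exponents add up on the circle only, hence the passage through almost everywhere
    equality.\<close>
  then show "corr (\<lambda>z. z powi k * z powi l) (translate (of_int k) (translate (of_int l) \<phi>))"
  proof (rule L2_corr_AE_cong)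
    show "AE z in circle_haar. z powi k * z powi l = z powi (k + l)"
      by (rule AE_I2, subst power_int_add) (auto simp: space_circle_haar)
  qed (simp_all add: circle_powi_mult_L2 L2_circle_powi translate_L2 father_L2 translate_translate)
qed (simp_all add: distrib_left mult.left_commute circle_powi_mult_L2 translate_lincomb translate_L2 L2_norm_translate)

text \<open>Multiplying by a character corresponds to translating, so the partner of
  \<open>z powi k * m\<^sub>0 z\<close> is a translate of \<open>dilation \<phi>\<close>, and
  partners have equal inner products.\<close>

lemma filter_norm_sq_coeff:
  "(LINT z|circle_haar. (cmod (m\<^sub>0 z))\<^sup>2 *\<^sub>R z powi k)
    = L2_inner lborel (translate (of_int k) (dilation \<phi>)) (dilation \<phi>)"
  using corr_inner[OF corr_translate[OF corr_filter, of k] corr_translate[OF corr_filter, of 0]]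
    L2_inner_circle_powi[OF L2_measurable[OF filter_L2], of k 0]
  by (simp add: translate_0)

text \<open>An even translation passes through the dilation as an integer translation of \<phi>, so
  these coefficients express orthonormality of the family.\<close>

lemma filter_norm_sq_even_coeff:
  "(LINT z|circle_haar. (cmod (m\<^sub>0 z))\<^sup>2 *\<^sub>R z powi (2 * k)) = (if k = 0 then 1 else 0)"
proof -
  have "translate (of_int (2 * k)) (dilation \<phi>) = dilation (translate (of_int k) \<phi>)"
    by (simp add: dilation_translate)
  then have "(LINT z|circle_haar. (cmod (m\<^sub>0 z))\<^sup>2 *\<^sub>R z powi (2 * k))
      = L2_inner lborel (translate (of_int k) \<phi>) \<phi>"
    unfolding filter_norm_sq_coeff by (simp only: L2_inner_dilation)
  then show ?thesis
    using father_orthonormal[of k 0] by (simp add: translate_0)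
qed

lemmas filter_isometry = filter_operator_isometry[OF filter_L2 filter_norm_sq_even_coeff]

text \<open>On generators: S_0 sends z^k to z^(2k) m_0, whose partner is U phi translated by 2k,
  which is U applied to phi translated by k.\<close>

lemma corr_filter_operator:
  assumes "corr f h" shows "corr (filter_operator m\<^sub>0 f) (dilation h)"
proof (rule L2_corr_map[OF assms])
  fix k
  have "filter_operator m\<^sub>0 (\<lambda>z. z powi k) = (\<lambda>z. z powi (2 * k) * m\<^sub>0 z)"
    by (simp add: filter_operator_def power_int_mult fun_eq_iff)
  moreover have "dilation (translate (of_int k) \<phi>) = translate (of_int (2 * k)) (dilation \<phi>)"
    by (simp add: dilation_translate)
  ultimately show "corr (filter_operator m\<^sub>0 (\<lambda>z. z powi k)) (dilation (translate (of_int k) \<phi>))"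
    using corr_translate[OF corr_filter, of "2 * k"] by simp
qed (simp_all add: filter_operator_lincomb dilation_lincomb dilation_L2 L2_norm_dilation
    filter_operator_L2[OF filter_L2 filter_norm_sq_even_coeff])

lemma corr_filter_operator_funpow:
  "corr f h \<Longrightarrow> corr ((filter_operator m\<^sub>0 ^^ n) f) ((dilation ^^ n) h)"
  by (induction n) (simp_all add: corr_filter_operator)

abbreviation (input) "V\<^sub>0 \<equiv> L2_closure lborel (fun_span (range (\<lambda>k::int. translate (of_int k) \<phi>)))"

lemma translates_L2: "range (\<lambda>k::int. translate (of_int k) \<phi>) \<subseteq> L2 lborel"
  using translate_L2[OF father_L2] by blast

lemma translate_in_V0: "translate (of_int (k::int)) \<phi> \<in> V\<^sub>0"
  using L2_closure_subset[OF fun_span_L2[OF translates_L2]] fun_span_base by blast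

lemma corr_in_V0: "corr f h \<Longrightarrow> h \<in> V\<^sub>0"
  using L2_corr_range[OF _ L2_closed_subspace_closure_span[OF translates_L2]] translate_in_V0
  by blast

lemma dilation_funpow_L2:
  "f \<in> L2 lborel \<Longrightarrow> (dilation ^^ n) f \<in> L2 lborel \<and> L2_norm lborel ((dilation ^^ n) f) = L2_norm lborel f"
  by (induction n) (simp_all add: dilation_L2 L2_norm_dilation)

lemma dilation_funpow_diff:
  "(dilation ^^ n) (\<lambda>x. f x - g x) = (\<lambda>x. (dilation ^^ n) f x - (dilation ^^ n) g x)"
  by (induction n) (simp_all add: dilation_def right_diff_distrib)

lemma inv_dilation_funpow_L2: "f \<in> L2 lborel \<Longrightarrow> (inv dilation ^^ n) f \<in> L2 lborel"
  by (induction n) (simp_all add: inv_dilation_L2)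

text \<open>For nonnegative \<open>n\<close> the range hypothesis is transported by the isometry;
  for negative \<open>n\<close> it suffices that U maps partners into \<open>V\<^sub>0\<close>, so
  that V_n contains them.\<close>

lemma corr_in_multires_space:
  assumes h: "corr f h" and range: "\<And>n. f \<in> L2_range circle_haar (filter_operator m\<^sub>0 ^^ n)"
  shows "h \<in> multires_space \<phi> n"
proof (cases "n \<ge> 0")
  case True
  \<comment> \<open>The space is an exact image, so \<open>h\<close> itself needs a preimage,
    whereas the range hypothesis only gives a partner \<open>i\<close> with \<open>h\<close> equal
    to its dilate almost everywhere. The exact preimage \<open>j\<close> agrees with
    \<open>i\<close> almost everywhere and so lies in \<open>V\<^sub>0\<close>.\<close>
  define j where "j = (inv dilation ^^ nat n) h"
  have dil_j: "(dilation ^^ nat n) j = h"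
    using fn_o_inv_fn_is_id[OF bij_dilation, of "nat n"] by (simp add: j_def fun_eq_iff)
  have h_L2: "h \<in> L2 lborel" using L2_corr_L2[OF h] by simp
  then have j_L2: "j \<in> L2 lborel" unfolding j_def by (rule inv_dilation_funpow_L2)
  obtain g where g: "g \<in> L2 circle_haar" "AE z in circle_haar. f z = (filter_operator m\<^sub>0 ^^ nat n) g z"
    using range[of "nat n"] by (auto simp: L2_range_def)
  obtain i where i: "corr g i" using corr_total[OF g(1)] by blast
  have i_L2: "i \<in> L2 lborel" using L2_corr_L2[OF i] by simp
  have diff_L2: "(\<lambda>x. j x - i x) \<in> L2 lborel" by (rule L2_diff[OF j_L2 i_L2])
  have "AE x in lborel. h x = (dilation ^^ nat n) i x"
    by (rule corr_unique[OF h corr_filter_operator_funpow[OF i] g(2)])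
  then have "AE x in lborel. (dilation ^^ nat n) (\<lambda>x. j x - i x) x = 0"
    unfolding dilation_funpow_diff dil_j by eventually_elim simp
  then have "L2_norm lborel (\<lambda>x. j x - i x) = 0"
    using dilation_funpow_L2[OF diff_L2, of "nat n"] L2_norm_eq_0_iff by metis
  then have "AE x in lborel. j x = i x"
    using L2_norm_eq_0_iff[OF diff_L2] by simp
  then have "j \<in> V\<^sub>0"
    by (rule L2_closed_subspace_AE[OF L2_closed_subspace_closure_span[OF translates_L2] j_L2
        corr_in_V0[OF i]])
  then show ?thesis
    using True dil_j by (auto simp: multires_space_def dilation_pow_def)
next
  case False
  have "(dilation ^^ nat (- n)) h \<in> V\<^sub>0"
    by (rule corr_in_V0[OF corr_filter_operator_funpow[OF h]])
  moreover have "(inv dilation ^^ nat (- n)) ((dilation ^^ nat (- n)) h) = h"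
    using inv_fn_o_fn_is_id[OF bij_dilation, of "nat (- n)"] by (simp add: fun_eq_iff)
  ultimately show ?thesis
    using False unfolding multires_space_def dilation_pow_def by (auto intro: image_eqI[rotated])
qed

lemma filter_operator_shift: "L2_shift circle_haar (filter_operator m\<^sub>0)"
  unfolding L2_shift_def
proof (intro conjI filter_isometry equalityI subsetI)
  fix f assume "f \<in> (\<Inter>n. L2_range circle_haar (filter_operator m\<^sub>0 ^^ n))"
  then have range: "f \<in> L2_range circle_haar (filter_operator m\<^sub>0 ^^ n)" for n by blast
  then have f: "f \<in> L2 circle_haar" by (auto simp: L2_range_def)
  then obtain h where h: "corr f h" using corr_total by blast
  have "h \<in> (\<Inter>n. multires_space \<phi> n)"
    using corr_in_multires_space[OF h range] by blast
  then have "h \<in> L2_zero lborel"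
    using father unfolding scale2_father_def by metis
  then have "L2_norm lborel h = 0"
    using L2_norm_eq_0_iff by (auto simp: L2_zero_def)
  then have "L2_norm circle_haar f = 0" using corr_norm[OF h] by simp
  then show "f \<in> L2_zero circle_haar"
    using L2_norm_eq_0_iff[OF f] f by (simp add: L2_zero_def)
next
  fix f assume "f \<in> L2_zero circle_haar"
  then have f: "f \<in> L2 circle_haar" "AE z in circle_haar. f z = 0" by (auto simp: L2_zero_def)
  have "(filter_operator m\<^sub>0 ^^ n) (\<lambda>z. 0) = (\<lambda>z. 0)" for n
    by (induction n) (simp_all add: filter_operator_def)
  then show "f \<in> (\<Inter>n. L2_range circle_haar (filter_operator m\<^sub>0 ^^ n))"
    using f L2_0 by (auto simp: L2_range_def intro!: bexI[of _ "\<lambda>z. 0"])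
qed

section \<open>Orthogonality of dyadic translates\<close>

lemma dilation_father_in_V0: "dilation \<phi> \<in> V\<^sub>0"
proof -
  have "multires_space \<phi> 0 = V\<^sub>0" by (simp add: multires_space_def dilation_pow_def)
  then show ?thesis using father by (simp add: scale2_father_def)
qed

text \<open>The hypothesis is orthogonality of every generator of \<open>V\<^sub>0\<close> to every
  translated generator, since only the difference of their indices matters. It extends to the closed
  span in one argument and then in the other.\<close>

lemma translate_V0_orthogonal:
  assumes s: "\<And>k::int. L2_inner lborel (translate (of_int k + s) \<phi>) \<phi> = 0"
    and f: "f \<in> V\<^sub>0" and g: "g \<in> V\<^sub>0"
  shows "L2_inner lborel (translate s f) g = 0"
proof -
  have g_L2: "g \<in> L2 lborel" using g by (simp add: L2_closure_def)
  have gen: "L2_inner lborel (translate s (translate (of_int j) \<phi>)) (translate (of_int i) \<phi>) = 0"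
    for i j :: int
    using s[of "j - i"] by (simp add: translate_translate
        L2_inner_translate_left[of "s + of_int j"] L2_inner_translate_left[of _ \<phi> \<phi>]
        L2_inner_translate_left[of _ "\<phi>" "translate _ \<phi>"] algebra_simps)
  have gen': "L2_inner lborel (translate (of_int i) \<phi>) (translate s (translate (of_int j) \<phi>)) = 0"
    for i j :: int
    using arg_cong[OF gen[of j i], of cnj] by (simp add: L2_inner_cnj)
  have "L2_inner lborel g (translate s (translate (of_int j) \<phi>)) = 0" for j :: int
  proof -
    let ?D = "{g \<in> L2 lborel. L2_inner lborel g (translate s (translate (of_int j) \<phi>)) = 0}"
    have "range (\<lambda>i::int. translate (of_int i) \<phi>) \<subseteq> ?D"
      using gen' translate_L2[OF father_L2] by blast
    then have "V\<^sub>0 \<subseteq> ?D"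
      by (intro L2_closure_span_least L2_closed_subspace_orthogonal translate_L2 father_L2)
    then show ?thesis using g by blast
  qed
  then have "L2_inner lborel (translate (of_int j) \<phi>) (translate (- s) g) = 0" for j :: int
    using L2_inner_translate_left L2_inner_cnj by (metis complex_cnj_zero)
  then have "range (\<lambda>j::int. translate (of_int j) \<phi>) \<subseteq> {f \<in> L2 lborel. L2_inner lborel f (translate (- s) g) = 0}"
    using translate_L2[OF father_L2] by blast
  then have "V\<^sub>0 \<subseteq> {f \<in> L2 lborel. L2_inner lborel f (translate (- s) g) = 0}"
    by (intro L2_closure_span_least L2_closed_subspace_orthogonal translate_L2 g_L2)
  then show ?thesis using f by (auto simp: L2_inner_translate_left)
qed

text \<open>Halving \<open>s\<close> turns \<open>\<langle>translate s \<phi>, \<phi>\<rangle>\<close> into the same expression for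
  \<open>dilation \<phi> \<in> V\<^sub>0\<close>: integers are settled by the Fourier coefficients of \<open>|m\<^sub>0|\<^sup>2\<close>,
  all other \<open>s\<close> by orthogonality of \<open>V\<^sub>0\<close> to its translate.\<close>

lemma dyadic_translates_orthogonal:
  assumes unimodular: "AE z in circle_haar. cmod (m\<^sub>0 z) = 1" and "q \<noteq> 0"
  shows "L2_inner lborel (translate (of_int q / 2 ^ n) \<phi>) \<phi> = 0"
  using \<open>q \<noteq> 0\<close>
proof (induction n arbitrary: q)
  case 0
  then show ?case
    using father_orthonormal[of q 0] by (simp add: translate_0)
next
  case (Suc n)
  define s where "s = real_of_int q / 2 ^ n"
  have "L2_inner lborel (translate s (dilation \<phi>)) (dilation \<phi>) = 0"
  proof (cases "2 ^ n dvd q")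
    case True
    then obtain k where k: "q = 2 ^ n * k" by blast
    with Suc.prems have "k \<noteq> 0" by auto
    have "m\<^sub>0 \<in> borel_measurable circle_haar" by (rule L2_measurable[OF filter_L2])
    then have "(LINT z|circle_haar. (cmod (m\<^sub>0 z))\<^sup>2 *\<^sub>R z powi k) = (LINT z|circle_haar. z powi k)"
      using unimodular L2_measurable[OF L2_circle_powi] by (intro integral_cong_AE) auto
    moreover have "s = of_int k" by (simp add: s_def k)
    ultimately show ?thesis
      using filter_norm_sq_coeff[of k] \<open>k \<noteq> 0\<close> by (simp add: circle_haar_integral_powi)
  next
    case False
    show ?thesis
    proof (rule translate_V0_orthogonal[OF _ dilation_father_in_V0 dilation_father_in_V0])
      fix k :: int
      \<comment> \<open>Since \<open>s\<close> is not an integer, none of its integer shifts is 0,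
        and all have denominator \<open>2 ^ n\<close>; this is why the induction hypothesis ranges
        over all nonzero numerators.\<close>
      have "2 ^ n * k + q \<noteq> 0" using False by (metis add_eq_0_iff dvd_minus_iff dvd_triv_left)
      moreover have "of_int k + s = of_int (2 ^ n * k + q) / 2 ^ n"
        by (simp add: s_def field_simps)
      ultimately show "L2_inner lborel (translate (of_int k + s) \<phi>) \<phi> = 0"
        using Suc.IH by metis
    qed
  qed
  moreover have "translate s (dilation \<phi>) = dilation (translate (of_int q / 2 ^ Suc n) \<phi>)"
    by (simp add: dilation_translate s_def)
  ultimately show ?case by (simp only: L2_inner_dilation)
qed

lemma filter_not_unimodular: "\<not> (AE z in circle_haar. cmod (m\<^sub>0 z) = 1)"
proof
  assume unimodular: "AE z in circle_haar. cmod (m\<^sub>0 z) = 1"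
  define s where "s n = 1 / (2::real) ^ n" for n :: nat
  have "L2_inner lborel \<phi> \<phi> = 1"
    using father_orthonormal[of 0 0] by (simp add: translate_0)
  then have norm: "(L2_norm lborel \<phi>)\<^sup>2 = 1"
    unfolding L2_inner_self using of_real_eq_1_iff by blast
  \<comment> \<open>Pythagoras for two orthogonal unit vectors; the distance therefore stays away
    from 0 as the translation shrinks.\<close>
  have dist: "(L2_norm lborel (\<lambda>x. \<phi> x - translate (s n) \<phi> x))\<^sup>2 = 2" for n
  proof -
    have "L2_inner lborel (translate (s n) \<phi>) \<phi> = 0"
      using dyadic_translates_orthogonal[OF unimodular, of 1 n] by (simp add: s_def)
    then have "L2_inner lborel \<phi> (translate (s n) \<phi>) = 0"
      using L2_inner_cnj by (metis complex_cnj_zero)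
    then show ?thesis
      using L2_norm_lincomb_sq[OF father_L2 translate_L2[OF father_L2], of 1 "-1" "s n"] norm
      by (simp add: L2_norm_translate)
  qed
  have "s \<longlonglongrightarrow> 0"
    unfolding s_def power_one_over[symmetric] by (rule LIMSEQ_power_zero) simp
  then have "(\<lambda>n. L2_norm lborel (\<lambda>x. \<phi> x - translate (s n) \<phi> x)) \<longlonglongrightarrow> 0"
    by (rule tendsto_translate[OF father_L2])
  then have "(\<lambda>n. (L2_norm lborel (\<lambda>x. \<phi> x - translate (s n) \<phi> x))\<^sup>2) \<longlonglongrightarrow> 0\<^sup>2"
    by (rule tendsto_power)
  then have "(\<lambda>n::nat. 2::real) \<longlonglongrightarrow> 0" unfolding dist by simp
  then show False by (simp add: LIMSEQ_const_iff)
qed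

end

theorem lemma9p3:
  fixes \<phi> :: "real \<Rightarrow> complex" and a :: "int \<Rightarrow> complex" and m\<^sub>0 :: "complex \<Rightarrow> complex"
  assumes "scale2_father \<phi>"
    and "L2_has_sum lborel (\<lambda>k x. a k * translate (of_int k) \<phi> x) (dilation \<phi>) UNIV"
    and "L2_has_sum circle_haar (\<lambda>k z. a k * z powi k) m\<^sub>0 UNIV"
  shows "measure circle_haar {z \<in> space circle_haar. cmod (m\<^sub>0 z) \<noteq> 1} > 0
       \<and> L2_shift circle_haar (filter_operator m\<^sub>0)"
proof
  have [measurable]: "m\<^sub>0 \<in> borel_measurable circle_haar"
    using filter_L2[OF assms] by (rule L2_measurable)
  have "{z \<in> space circle_haar. cmod (m\<^sub>0 z) \<noteq> 1} \<in> sets circle_haar" by measurable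
  then have "measure circle_haar {z \<in> space circle_haar. cmod (m\<^sub>0 z) \<noteq> 1} \<noteq> 0"
    using filter_not_unimodular[OF assms] circle.prob_eq_0 by (auto simp: circle.AE_prob_1)
  then show "measure circle_haar {z \<in> space circle_haar. cmod (m\<^sub>0 z) \<noteq> 1} > 0"
    by (simp add: zero_less_measure_iff)
  show "L2_shift circle_haar (filter_operator m\<^sub>0)"
    by (rule filter_operator_shift[OF assms])
qed

end
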